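(* Consider the SOS-convex semi-algebraic program $(P)$: minimize $f_0(x)$ over $x\in\mathbb{R}^n$ subject to $f_i(x)\le 0$, $i=1,\ldots,s$, where $f_0,\ldots,f_s$ are SOS-convex semi-algebraic functions with the representations fixed in the context, and let $(SDP^* )$ be the semidefinite program defined in the context. Suppose that the following strict feasibility conditions hold: (i) there exists $\bar x\in\mathbb{R}^n$ such that $f_i(\bar x)<0$ for all $i=1,\ldots,s$; (ii) for each $i=0,1,\ldots,s$, there exist $\bar y^i\in\mathbb{R}^m$ and $\bar z^i\in\mathbb{R}^{p_i}$ such that $A_0^i+\sum_{j=1}^m\bar y_j^iA_j^i+\sum_{l=1}^{p_i}\bar z_l^iB_l^i\succ 0$. Let $(y^*,Z_0^*,Z_1^*,\ldots,Z_s^* )$ be an optimal solution of $(SDP^* )$ and let $x^*:=(L_{y^*}(X_1),\ldots,L_{y^*}(X_n))^T\in\mathbb{R}^n$, where $X_k$ denotes the polynomial which maps a vector $x\in\mathbb{R}^n$ to its $k$-th coordinate. Then $x^*$ is an optimal solution of $(P)$.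
   Context: A real polynomial is sums-of-squares if it is a finite sum of squares of real polynomials. A real polynomial $f$ on $\mathbb{R}^n$ is SOS-convex if the polynomial $(x,y)\mapsto f(x)-f(y)-\nabla f(y)^T(x-y)$ is sums-of-squares on $\mathbb{R}^n\times\mathbb{R}^n$. For symmetric matrices, $M\succeq 0$ (resp. $M\succ 0$) means $M$ is positive semidefinite (resp. positive definite), and $\mathrm{Tr}$ is the trace. Setting of $(P)$: $d$ is a positive even number, and for each $i=0,1,\ldots,s$, $f_i:\mathbb{R}^n\to\mathbb{R}$ is an SOS-convex semi-algebraic function given by $$f_i(x)=\sup_{(y_1^i,\ldots,y_m^i)\in\Omega_i}\Big\{h_0^i(x)+\sum_{j=1}^m y_j^i h_j^i(x)\Big\},\quad m\in\mathbb{N},$$ where (1) each $h_j^i$ ($j=0,1,\ldots,m$) is a real polynomial on $\mathbb{R}^n$ of degree at most $d$, and for each $y^i=(y_1^i,\ldots,y_m^i)\in\Omega_i$ the polynomial $h_0^i+\sum_{j=1}^m y_j^i h_j^i$ is SOS-convex; (2) $\Omega_i$ is a nonempty compact set of the form $$\Omega_i=\Big\{(y_1^i,\ldots,y_m^i)\in\mathbb{R}^m:\ \exists\, z^i=(z_1^i,\ldots,z_{p_i}^i)\in\mathbb{R}^{p_i}\text{ s.t. }A_0^i+\sum_{j=1}^m y_j^iA_j^i+\sum_{l=1}^{p_i}z_l^iB_l^i\succeq 0\Big\}$$ for some $p_i\in\mathbb{N}$ and some real symmetric matrices $A_j^i,B_l^i$ (all of the same size for fixed $i$). Notation: $s(r,n)$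 is the dimension of the space $\mathbb{R}_r[x_1,\ldots,x_n]$ of real polynomials on $\mathbb{R}^n$ of degree at most $r$. The monomials of degree at most $r$ are listed in the order $x^{(r)}=(1,x_1,\ldots,x_n,x_1^2,x_1x_2,\ldots,x_n^2,\ldots,x_1^r,\ldots,x_n^r)^T$ (increasing degree), $x^{(r)}_\alpha$ is the $\alpha$-th one, $1\le\alpha\le s(r,n)$, and $i(\alpha)$ is its multi-index of exponents. For a polynomial $u=\sum_{\alpha=1}^{s(r,n)}u_\alpha x^{(r)}_\alpha$, $u_\alpha$ denotes its $\alpha$-th coefficient, and for $y\in\mathbb{R}^{s(r,n)}$, $L_y(u):=\sum_{\alpha=1}^{s(r,n)}u_\alpha y_\alpha$ (here used with $r=d$). For $y\in\mathbb{R}^{s(d,n)}$, the moment matrix $\mathbf{M}_{d/2}(y)$ is the symmetric $s(d/2,n)\times s(d/2,n)$ matrix whose $(\beta,\gamma)$ entry is $y_\alpha$, where $\alpha$ is the index with $i(\alpha)=i(\beta)+i(\gamma)$. The problem $(SDP^* )$ is: minimize $$\sum_{1\le\alpha\le s(d,n)}(h_0^0)_\alpha y_\alpha+\mathrm{Tr}(Z_0A_0^0)$$ over $y=(y_\alpha)\in\mathbb{R}^{s(d,n)}$ and symmetric matrices $Z_i\succeq 0$, $i=0,\ldots,s$ ($Z_i$ of the same size as the $A_j^i$), subject to $$\sum_{1\le\alpha\le s(d,n)}(h_0^i)_\alpha y_\alpha+\mathrm{Tr}(Z_iA_0^i)\le 0,\quad i=1,\ldots,s,$$ $$\sum_{1\le\alpha\le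 s(d,n)}(h_j^i)_\alpha y_\alpha+\mathrm{Tr}(Z_iA_j^i)=0,\quad i=0,1,\ldots,s,\ j=1,\ldots,m,$$ $$\mathrm{Tr}(Z_iB_l^i)=0,\quad i=0,1,\ldots,s,\ l=1,\ldots,p_i,$$ $$\mathbf{M}_{d/2}(y)\succeq 0,\qquad y_1=1.$$ *)

theory Defs
  imports "HOL-Analysis.Analysis" "HOL-Library.Poly_Mapping"
begin

text \<open>
  Real polynomials in variables indexed by the finite type \<open>'v\<close>: a polynomial maps each
  multi-index of exponents to its coefficient. The ring operations are those of
  \<open>Poly_Mapping\<close>, i.e. multiplication is convolution.
\<close>

type_synonym 'v midx = "'v \<Rightarrow>\<^sub>0 nat"
type_synonym 'v mpoly = "'v midx \<Rightarrow>\<^sub>0 real"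

definition mdeg :: "('v::finite) midx \<Rightarrow> nat" where
  "mdeg \<alpha> = (\<Sum>k\<in>UNIV. Poly_Mapping.lookup \<alpha> k)"

definition midx_upto :: "nat \<Rightarrow> ('v::finite) midx set" where
  "midx_upto r = {\<alpha>. mdeg \<alpha> \<le> r}"

definition poly_deg_le :: "('v::finite) mpoly \<Rightarrow> nat \<Rightarrow> bool" where
  "poly_deg_le u r \<longleftrightarrow> Poly_Mapping.keys u \<subseteq> midx_upto r"

definition peval :: "('v::finite) mpoly \<Rightarrow> real ^ 'v \<Rightarrow> real" where
  "peval u x = (\<Sum>\<alpha>\<in>Poly_Mapping.keys u.
     Poly_Mapping.lookup u \<alpha> * (\<Prod>k\<in>UNIV. (x $ k) ^ Poly_Mapping.lookup \<alpha> k))"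

definition pconst :: "real \<Rightarrow> ('v::finite) mpoly" where
  "pconst c = Poly_Mapping.single 0 c"

definition pvar :: "'v \<Rightarrow> ('v::finite) mpoly" where
  "pvar k = Poly_Mapping.single (Poly_Mapping.single k 1) 1"

definition sums_of_squares :: "('v::finite) mpoly \<Rightarrow> bool" where
  "sums_of_squares u \<longleftrightarrow> (\<exists>(N::nat) q. u = (\<Sum>k<N. (q k)\<^sup>2))"

text \<open>
  Below, \<open>g\<close> is the gradient of \<open>f\<close> (unique by uniqueness of derivatives), and \<open>P\<close> is the
  (unique) polynomial on \<open>\<real>\<^sup>n \<times> \<real>\<^sup>n\<close> with \<open>P(x,y) = f(x) - f(y) - g(y)\<^sup>T(x - y)\<close>; its variables
  are indexed by \<open>'n + 'n\<close>, the left summand belonging to \<open>x\<close> and the right one to \<open>y\<close>.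
\<close>

definition sos_convex :: "('n::finite) mpoly \<Rightarrow> bool" where
  "sos_convex f \<longleftrightarrow>
     (\<exists>(g :: real ^ 'n \<Rightarrow> real ^ 'n) (P :: ('n + 'n) mpoly).
        (\<forall>y. GDERIV (peval f) y :> g y) \<and>
        (\<forall>x y. peval P (\<chi> k. case k of Inl a \<Rightarrow> x $ a | Inr b \<Rightarrow> y $ b) =
               peval f x - peval f y - g y \<bullet> (x - y)) \<and>
        sums_of_squares P)"

text \<open>
  Matrices with rows and columns indexed by a finite set \<open>I\<close> are functions of two arguments;
  values outside \<open>I \<times> I\<close> are irrelevant. A matrix of size \<open>k\<close> has \<open>I = {..<k}\<close>.
\<close>

definition sym_matrix :: "'i set \<Rightarrow> ('i \<Rightarrow> 'i \<Rightarrow> real) \<Rightarrow> bool" where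
  "sym_matrix I M \<longleftrightarrow> (\<forall>a\<in>I. \<forall>b\<in>I. M a b = M b a)"

definition quad_form :: "'i set \<Rightarrow> ('i \<Rightarrow> 'i \<Rightarrow> real) \<Rightarrow> ('i \<Rightarrow> real) \<Rightarrow> real" where
  "quad_form I M v = (\<Sum>a\<in>I. \<Sum>b\<in>I. v a * M a b * v b)"

definition psd :: "'i set \<Rightarrow> ('i \<Rightarrow> 'i \<Rightarrow> real) \<Rightarrow> bool" where
  "psd I M \<longleftrightarrow> sym_matrix I M \<and> (\<forall>v. 0 \<le> quad_form I M v)"

definition posdef :: "'i set \<Rightarrow> ('i \<Rightarrow> 'i \<Rightarrow> real) \<Rightarrow> bool" where
  "posdef I M \<longleftrightarrow> sym_matrix I M \<and> (\<forall>v. (\<exists>a\<in>I. v a \<noteq> 0) \<longrightarrow> 0 < quad_form I M v)"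

definition matrix_prod :: "'i set \<Rightarrow> ('i \<Rightarrow> 'i \<Rightarrow> real) \<Rightarrow> ('i \<Rightarrow> 'i \<Rightarrow> real) \<Rightarrow> 'i \<Rightarrow> 'i \<Rightarrow> real" where
  "matrix_prod I M N a b = (\<Sum>c\<in>I. M a c * N c b)"

definition matrix_trace :: "'i set \<Rightarrow> ('i \<Rightarrow> 'i \<Rightarrow> real) \<Rightarrow> real" where
  "matrix_trace I M = (\<Sum>a\<in>I. M a a)"

definition pencil ::
  "nat \<Rightarrow> nat \<Rightarrow> (nat \<Rightarrow> nat \<Rightarrow> nat \<Rightarrow> real) \<Rightarrow> (nat \<Rightarrow> nat \<Rightarrow> nat \<Rightarrow> real) \<Rightarrow>
   (nat \<Rightarrow> real) \<Rightarrow> (nat \<Rightarrow> real) \<Rightarrow> nat \<Rightarrow> nat \<Rightarrow> real" where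
  "pencil m p A B y z a b = A 0 a b + (\<Sum>j=1..m. y j * A j a b) + (\<Sum>l=1..p. z l * B l a b)"

text \<open>
  \<open>\<real>\<^sup>m\<close> is rendered as the extensional functions on \<open>{1..m}\<close>, which is the carrier of
  \<open>powertop_real {1..m}\<close>. Here \<open>k\<close> is the size of the matrices.
\<close>

definition spectrahedral ::
  "nat \<Rightarrow> nat \<Rightarrow> nat \<Rightarrow> (nat \<Rightarrow> nat \<Rightarrow> nat \<Rightarrow> real) \<Rightarrow> (nat \<Rightarrow> nat \<Rightarrow> nat \<Rightarrow> real) \<Rightarrow>
   (nat \<Rightarrow> real) set" where
  "spectrahedral k m p A B =
     {y \<in> {1..m} \<rightarrow>\<^sub>E UNIV. \<exists>z. psd {..<k} (pencil m p A B y z)}"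

definition sup_function ::
  "nat \<Rightarrow> (nat \<Rightarrow> ('n::finite) mpoly) \<Rightarrow> (nat \<Rightarrow> real) set \<Rightarrow> real ^ 'n \<Rightarrow> real" where
  "sup_function m h \<Omega> x = (SUP y\<in>\<Omega>. peval (h 0) x + (\<Sum>j=1..m. y j * peval (h j) x))"

text \<open>
  Vectors of \<open>\<real>\<^sup>s\<^sup>(\<^sup>d\<^sup>,\<^sup>n\<^sup>)\<close> are indexed directly by the multi-indices of degree at most \<open>d\<close> instead
  of by their positions in the list of monomials; the multi-index \<open>0\<close> is the first position.
\<close>

definition riesz :: "nat \<Rightarrow> (('n::finite) midx \<Rightarrow> real) \<Rightarrow> 'n mpoly \<Rightarrow> real" where
  "riesz d y u = (\<Sum>\<alpha>\<in>midx_upto d. Poly_Mapping.lookup u \<alpha> * y \<alpha>)"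

definition moment_matrix :: "(('n::finite) midx \<Rightarrow> real) \<Rightarrow> 'n midx \<Rightarrow> 'n midx \<Rightarrow> real" where
  "moment_matrix y \<beta> \<gamma> = y (\<beta> + \<gamma>)"

definition sdp_objective ::
  "nat \<Rightarrow> (nat \<Rightarrow> nat) \<Rightarrow> (nat \<Rightarrow> nat \<Rightarrow> ('n::finite) mpoly) \<Rightarrow>
   (nat \<Rightarrow> nat \<Rightarrow> nat \<Rightarrow> nat \<Rightarrow> real) \<Rightarrow>
   ('n midx \<Rightarrow> real) \<times> (nat \<Rightarrow> nat \<Rightarrow> nat \<Rightarrow> real) \<Rightarrow> real" where
  "sdp_objective d k h A = (\<lambda>(y, Z).
     riesz d y (h 0 0) + matrix_trace {..<k 0} (matrix_prod {..<k 0} (Z 0) (A 0 0)))"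

definition sdp_feasible ::
  "nat \<Rightarrow> nat \<Rightarrow> nat \<Rightarrow> (nat \<Rightarrow> nat) \<Rightarrow> (nat \<Rightarrow> nat) \<Rightarrow> (nat \<Rightarrow> nat \<Rightarrow> ('n::finite) mpoly) \<Rightarrow>
   (nat \<Rightarrow> nat \<Rightarrow> nat \<Rightarrow> nat \<Rightarrow> real) \<Rightarrow> (nat \<Rightarrow> nat \<Rightarrow> nat \<Rightarrow> nat \<Rightarrow> real) \<Rightarrow>
   ('n midx \<Rightarrow> real) \<times> (nat \<Rightarrow> nat \<Rightarrow> nat \<Rightarrow> real) \<Rightarrow> bool" where
  "sdp_feasible d s m p k h A B = (\<lambda>(y, Z).
     (\<forall>i\<in>{0..s}. psd {..<k i} (Z i)) \<and>
     (\<forall>i\<in>{1..s}. riesz d y (h i 0) +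
        matrix_trace {..<k i} (matrix_prod {..<k i} (Z i) (A i 0)) \<le> 0) \<and>
     (\<forall>i\<in>{0..s}. \<forall>j\<in>{1..m}. riesz d y (h i j) +
        matrix_trace {..<k i} (matrix_prod {..<k i} (Z i) (A i j)) = 0) \<and>
     (\<forall>i\<in>{0..s}. \<forall>l\<in>{1..p i}.
        matrix_trace {..<k i} (matrix_prod {..<k i} (Z i) (B i l)) = 0) \<and>
     psd (midx_upto (d div 2)) (moment_matrix y) \<and>
     y 0 = 1)"

text \<open>Sums over \<open>midx_upto r\<close> are genuine finite sums:\<close>

lemma finite_midx_upto: "finite (midx_upto r :: ('v::finite) midx set)"
proof (rule finite_imageD)
  have "Poly_Mapping.lookup ` (midx_upto r :: 'v midx set) \<subseteq> (\<Pi>\<^sub>E k\<in>UNIV. {..r})"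
  proof (clarsimp simp: midx_upto_def mdeg_def PiE_def)
    fix \<alpha> :: "'v midx" and k
    assume "(\<Sum>k\<in>UNIV. Poly_Mapping.lookup \<alpha> k) \<le> r"
    moreover have "Poly_Mapping.lookup \<alpha> k \<le> (\<Sum>k\<in>UNIV. Poly_Mapping.lookup \<alpha> k)"
      by (rule member_le_sum) auto
    ultimately show "Poly_Mapping.lookup \<alpha> k \<le> r" by linarith
  qed
  then show "finite (Poly_Mapping.lookup ` (midx_upto r :: 'v midx set))"
    by (rule finite_subset) (auto intro: finite_PiE)
  show "inj_on Poly_Mapping.lookup (midx_upto r :: 'v midx set)"
    by (simp add: inj_on_def lookup_inject)
qed

end

theory Submission
  imports Defs
begin

text \<open>
  Jensen's inequality \<open>F(L\<^sub>y(X)) \<le> L\<^sub>y(F)\<close> holds for SOS-convex \<open>F\<close> of degree at most \<open>d\<close> and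
  \<open>M\<^sub>d\<^sub>/\<^sub>2(y) \<succeq> 0\<close>: the SOS certificate with base point \<open>L\<^sub>y(X)\<close> consists of squares of polynomials of
  degree at most \<open>d / 2\<close>, and its linear part is annihilated by \<open>L\<^sub>y\<close>. Combined with \<open>Tr(Z P) \<ge> 0\<close> for
  positive semidefinite \<open>Z\<close>, \<open>P\<close>, it bounds \<open>f\<^sub>i(x\<^sup>*)\<close> by \<open>L\<^sub>y(h\<^sub>0\<^sup>i) + Tr(Z\<^sub>i A\<^sub>0\<^sup>i)\<close>, so \<open>x\<^sup>*\<close> is
  feasible with value at most that of the SDP. Conversely, for a feasible \<open>x\<close> the number \<open>f\<^sub>i(x)\<close> is the value of a
  strictly feasible semidefinite program over \<open>\<Omega>\<^sub>i\<close>; the dual optimal solutions \<open>Z\<^sub>i\<close>, together with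
  the monomials evaluated at \<open>x\<close>, are feasible for the SDP with objective at most \<open>f\<^sub>0(x)\<close>.
\<close>

subsection \<open>Semidefinite duality\<close>

text \<open>Induction on the coordinates, without topology. If coordinate \<open>n\<close> keeps a
  weak sign on \<open>C\<close>, plus or minus that coordinate separates. Otherwise the functional
  obtained for the slice where it vanishes is extended by one coefficient, as in the Hahn-Banach
  theorem.\<close>

lemma separation_from_zero:
  fixes C :: "('i \<Rightarrow> real) set"
  assumes "finite I" and "C \<noteq> {}"
    and "\<And>x y u v. \<lbrakk>x \<in> C; y \<in> C; 0 \<le> u; 0 \<le> v; u + v = 1\<rbrakk> \<Longrightarrow> (\<lambda>i. u * x i + v * y i) \<in> C"
    and "\<And>x. x \<in> C \<Longrightarrow> \<exists>i\<in>I. x i \<noteq> 0"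
  shows "\<exists>a. (\<exists>i\<in>I. a i \<noteq> 0) \<and> (\<forall>x\<in>C. 0 \<le> (\<Sum>i\<in>I. a i * x i))"
  using assms
proof (induction I arbitrary: C rule: finite_induct)
  case empty
  then show ?case by auto
next
  case (insert n I)
  note conv = insert.prems(2)
  define dl where "dl = (\<lambda>i. if i = n then 1 else 0 :: real)"
  have dl: "(\<Sum>i\<in>insert n I. dl i * x i) = x n" for x
    using insert.hyps by (simp add: dl_def if_distrib cong: if_cong sum.cong) (auto intro!: sum.neutral)
  show ?case
  proof (cases "(\<forall>x\<in>C. 0 \<le> x n) \<or> (\<forall>x\<in>C. x n \<le> 0)")
    case True
    then show ?thesis
    proof
      assume "\<forall>x\<in>C. 0 \<le> x n"
      then show ?thesis using dl by (intro exI[of _ dl]) (auto simp: dl_def)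
    next
      assume "\<forall>x\<in>C. x n \<le> 0"
      moreover have "(\<Sum>i\<in>insert n I. - dl i * x i) = - x n" for x
        using dl[of x] by (simp add: sum_negf)
      ultimately show ?thesis by (intro exI[of _ "\<lambda>i. - dl i"]) (auto simp: dl_def)
    qed
  next
    case False
    then obtain xp xm where xp: "xp \<in> C" "0 < xp n" and xm: "xm \<in> C" "xm n < 0"
      by (metis not_le)
    define D where "D = {x\<in>C. x n = 0}"
    \<comment> \<open>The segment from \<open>x\<close> to \<open>w\<close> crosses the slice; these
      weights cancel coordinate \<open>n\<close>.\<close>
    have mix: "(\<lambda>i. (- w n) / (x n - w n) * x i + x n / (x n - w n) * w i) \<in> D"
      if "x \<in> C" "0 < x n" "w \<in> C" "w n < 0" for x w
      unfolding D_def
    proof (intro CollectI conjI)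
      show "(\<lambda>i. (- w n) / (x n - w n) * x i + x n / (x n - w n) * w i) \<in> C"
      proof (rule conv[OF that(1,3)])
        show "0 \<le> - w n / (x n - w n)" "0 \<le> x n / (x n - w n)"
          using that by (intro divide_nonneg_pos; linarith)+
        have "- w n / (x n - w n) + x n / (x n - w n) = (x n - w n) / (x n - w n)"
          by (simp only: add_divide_distrib[symmetric]) simp
        then show "- w n / (x n - w n) + x n / (x n - w n) = 1"
          using that by simp
      qed
    qed (simp add: field_simps)
    have "\<exists>a. (\<exists>i\<in>I. a i \<noteq> 0) \<and> (\<forall>x\<in>D. 0 \<le> (\<Sum>i\<in>I. a i * x i))"
    proof (rule insert.IH)
      show "D \<noteq> {}" using mix[OF xp xm] by blast
      show "(\<lambda>i. u * x i + v * y i) \<in> D"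
        if "x \<in> D" "y \<in> D" "0 \<le> u" "0 \<le> v" "u + v = 1" for x y u v
        using that conv[of x y u v] by (simp add: D_def)
      show "\<exists>i\<in>I. x i \<noteq> 0" if "x \<in> D" for x
        using that insert.prems(3)[of x] by (auto simp: D_def)
    qed
    then obtain a where a: "\<exists>i\<in>I. a i \<noteq> 0" "\<And>x. x \<in> D \<Longrightarrow> 0 \<le> (\<Sum>i\<in>I. a i * x i)"
      by blast
    define \<phi> where "\<phi> = (\<lambda>x. \<Sum>i\<in>I. a i * x i)"
    \<comment> \<open>Nonnegativity of \<open>\<phi>\<close> at the crossing point says that each
      lower bound on the new coefficient, from a point above the slice, is at most each upper bound
      from a point below.\<close>
    have key: "- \<phi> x / x n \<le> \<phi> w / (- w n)"
      if "x \<in> C" "0 < x n" "w \<in> C" "w n < 0" for x w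
    proof -
      have "0 \<le> \<phi> (\<lambda>i. (- w n) / (x n - w n) * x i + x n / (x n - w n) * w i)"
        unfolding \<phi>_def by (rule a(2)[OF mix[OF that]])
      also have "\<dots> = (- w n) / (x n - w n) * \<phi> x + x n / (x n - w n) * \<phi> w"
        by (simp only: \<phi>_def sum_distrib_left sum.distrib[symmetric]) (simp add: algebra_simps)
      also have "\<dots> = (- w n * \<phi> x + x n * \<phi> w) / (x n - w n)"
        by (simp add: add_divide_distrib diff_divide_distrib)
      finally have "0 \<le> - w n * \<phi> x + x n * \<phi> w"
        using that by (simp add: zero_le_divide_iff)
      then show ?thesis using that by (simp add: field_simps)
    qed
    \<comment> \<open>The least admissible coefficient: \<open>xp\<close> makes the set of lower
      bounds nonempty, and \<open>xm\<close> bounds it above.\<close>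
    define b where "b = (SUP x\<in>{x\<in>C. 0 < x n}. - \<phi> x / x n)"
    have b_ge: "- \<phi> x / x n \<le> b" if "x \<in> C" "0 < x n" for x
      unfolding b_def using that key[OF _ _ xm]
      by (intro cSUP_upper bdd_aboveI2[where M = "\<phi> xm / (- xm n)"]) auto
    have b_le: "b \<le> \<phi> w / (- w n)" if "w \<in> C" "w n < 0" for w
      unfolding b_def using xp key[OF _ _ that] by (intro cSUP_least) auto
    have "0 \<le> b * x n + \<phi> x" if "x \<in> C" for x
    proof (cases "x n" "0::real" rule: linorder_cases)
      case less
      then show ?thesis using b_le[OF that less] by (simp add: field_simps)
    next
      case equal
      then show ?thesis using a(2)[of x] that by (simp add: D_def \<phi>_def)
    next
      case greater
      then show ?thesis using b_ge[OF that greater] by (simp add: field_simps)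
    qed
    moreover have "(\<Sum>i\<in>I. (a(n := b)) i * x i) = \<phi> x" for x
      unfolding \<phi>_def using insert.hyps by (intro sum.cong) auto
    ultimately show ?thesis
      using a(1) insert.hyps by (intro exI[of _ "a(n := b)"]) (auto, metis)
  qed
qed

section \<open>Trace pairing and positive semidefinite matrices\<close>

definition frobenius :: "'i set \<Rightarrow> ('i \<Rightarrow> 'i \<Rightarrow> real) \<Rightarrow> ('i \<Rightarrow> 'i \<Rightarrow> real) \<Rightarrow> real" where
  "frobenius I M N = (\<Sum>a\<in>I. \<Sum>b\<in>I. M a b * N a b)"

lemma trace_prod_eq_frobenius:
  assumes "sym_matrix I N"
  shows "matrix_trace I (matrix_prod I M N) = frobenius I M N"
  using assms unfolding matrix_trace_def matrix_prod_def frobenius_def sym_matrix_def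
  by (intro sum.cong refl) simp

lemma frobenius_linear:
  "frobenius I M (\<lambda>a b. N a b + N' a b) = frobenius I M N + frobenius I M N'"
  "frobenius I M (\<lambda>a b. N a b - N' a b) = frobenius I M N - frobenius I M N'"
  "frobenius I M (\<lambda>a b. c * N a b) = c * frobenius I M N"
  "frobenius I M (\<lambda>a b. \<Sum>j\<in>J. F j a b) = (\<Sum>j\<in>J. frobenius I M (F j))"
proof -
  show "frobenius I M (\<lambda>a b. \<Sum>j\<in>J. F j a b) = (\<Sum>j\<in>J. frobenius I M (F j))"
    unfolding frobenius_def sum_distrib_left
    by (subst sum.swap[where B = J], subst (2) sum.swap[where A = J], rule refl)
qed (simp_all add: frobenius_def sum.distrib sum_subtractf sum_distrib_left algebra_simps)

lemma frobenius_scale_left: "frobenius I (\<lambda>a b. c * M a b) N = c * frobenius I M N"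
  by (simp add: frobenius_def sum_distrib_left algebra_simps)

lemma frobenius_outer: "frobenius I M (\<lambda>a b. v a * v b) = quad_form I M v"
  by (simp add: frobenius_def quad_form_def algebra_simps)

lemma quad_form_insert:
  assumes "finite I" "n \<notin> I" "sym_matrix (insert n I) M"
  shows "quad_form (insert n I) M v =
    quad_form I M v + 2 * v n * (\<Sum>a\<in>I. v a * M n a) + (v n)\<^sup>2 * M n n"
proof -
  have "M a n = M n a" if "a \<in> I" for a
    using assms(3) that unfolding sym_matrix_def by blast
  then have "(\<Sum>a\<in>I. v a * M a n * v n) = v n * (\<Sum>a\<in>I. v a * M n a)"
    unfolding sum_distrib_left by (intro sum.cong refl) simp
  moreover have "(\<Sum>a\<in>I. v n * M n a * v a) = v n * (\<Sum>a\<in>I. v a * M n a)"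
    unfolding sum_distrib_left by (intro sum.cong refl) simp
  moreover have "quad_form (insert n I) M v = v n * M n n * v n + (\<Sum>a\<in>I. v n * M n a * v a)
      + ((\<Sum>a\<in>I. v a * M a n * v n) + quad_form I M v)"
    using assms(1,2) by (simp add: quad_form_def sum.distrib)
  ultimately show ?thesis
    by (simp add: power2_eq_square)
qed

lemma quad_form_cong:
  "(\<And>a. a \<in> I \<Longrightarrow> v a = w a) \<Longrightarrow> quad_form I M v = quad_form I M w"
  by (simp add: quad_form_def cong: sum.cong)

lemma affine_nonneg_imp_slope_zero:
  fixes a b :: real
  assumes "\<And>t. 0 \<le> a + t * b"
  shows "b = 0"
proof (rule ccontr)
  assume "b \<noteq> 0"
  then show False using assms[of "(- a - 1) / b"] by simp
qed

lemma affine_nonneg_imp_slope_nonpos: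
  fixes a b :: real
  assumes "\<And>t. 0 < t \<Longrightarrow> 0 \<le> a - t * b"
  shows "b \<le> 0"
proof (rule ccontr)
  assume "\<not> b \<le> 0"
  moreover have "0 < (\<bar>a\<bar> + 1) / b" using calculation by simp
  ultimately show False using assms[of "(\<bar>a\<bar> + 1) / b"] by simp
qed

text \<open>On the line through the unit vector of \<open>a\<close> in the direction of the unit
  vector of \<open>n\<close>, the form is affine because its quadratic coefficient
  \<open>M n n\<close> is 0; an affine function bounded below is constant.\<close>

lemma psd_zero_diagonal:
  assumes I: "finite I" "n \<notin> I" and psd: "psd (insert n I) M" and "M n n = 0" and "a \<in> I"
  shows "M n a = 0"
proof -
  have "M a a + t * (2 * M n a) = quad_form (insert n I) M (\<lambda>c. if c = n then t else if c = a then 1 else 0)" for t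
  proof -
    have 1: "quad_form I M (\<lambda>c. if c = n then t else if c = a then 1 else 0) = M a a"
    proof -
      have "quad_form I M (\<lambda>c. if c = n then t else if c = a then 1 else 0)
          = (\<Sum>c\<in>I. \<Sum>e\<in>I. if c = a then if e = a then M c e else 0 else 0)"
        unfolding quad_form_def using I by (intro sum.cong refl) auto
      also have "\<dots> = (\<Sum>c\<in>I. if c = a then M c a else 0)"
        using I \<open>a \<in> I\<close> by (intro sum.cong refl) (auto simp: sum.delta)
      finally show ?thesis using I \<open>a \<in> I\<close> by (simp add: sum.delta)
    qed
    have 2: "(\<Sum>c\<in>I. (if c = n then t else if c = a then 1 else 0) * M n c) = M n a"
    proof -
      have "(\<Sum>c\<in>I. (if c = n then t else if c = a then 1 else 0) * M n c)
          = (\<Sum>c\<in>I. if c = a then M n c else 0)"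
        using I by (intro sum.cong) auto
      then show ?thesis using I \<open>a \<in> I\<close> by (simp add: sum.delta)
    qed
    show ?thesis
      using psd I \<open>M n n = 0\<close> by (simp add: quad_form_insert psd_def 1 2)
  qed
  then have "0 \<le> M a a + t * (2 * M n a)" for t
    using psd by (simp add: psd_def)
  then show ?thesis using affine_nonneg_imp_slope_zero by fastforce
qed

text \<open>Cholesky factorization; the induction step passes to the Schur complement, where the
  junk value \<open>x / 0 = 0\<close> takes care of a vanishing pivot.\<close>

lemma psd_factorization:
  assumes "finite I" "psd I M"
  obtains V where "\<And>a b. a \<in> I \<Longrightarrow> b \<in> I \<Longrightarrow> M a b = (\<Sum>c\<in>I. V c a * V c b)"
proof -
  have "\<exists>V. \<forall>a\<in>I. \<forall>b\<in>I. M a b = (\<Sum>c\<in>I. V c a * V c b)"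
    using assms
  proof (induction I arbitrary: M rule: finite_induct)
    case empty
    then show ?case by simp
  next
    case (insert n I)
    note psd = insert.prems
    have sym: "M a b = M b a" if "a \<in> insert n I" "b \<in> insert n I" for a b
      using psd that unfolding psd_def sym_matrix_def by blast
    have q: "quad_form (insert n I) M v =
        quad_form I M v + 2 * v n * (\<Sum>a\<in>I. v a * M n a) + (v n)\<^sup>2 * M n n" for v
      using psd insert.hyps by (intro quad_form_insert) (auto simp: psd_def)
    have pos: "0 \<le> quad_form (insert n I) M v" for v
      using psd by (simp add: psd_def)
    have "0 \<le> M n n"
      using pos[of "\<lambda>c. if c = n then 1 else 0"] insert.hyps
      by (simp add: q quad_form_def) (smt (verit) mult_eq_0_iff sum.neutral)
    have zero: "M n a = 0" if "M n n = 0" "a \<in> I" for a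
      using psd_zero_diagonal[OF insert.hyps psd] that by blast
    define M' where "M' = (\<lambda>a b. M a b - M n a * M n b / M n n)"
    have "psd I M'"
      unfolding psd_def
    proof (intro conjI allI)
      show "sym_matrix I M'"
        using sym by (simp add: sym_matrix_def M'_def)
      fix v
      define \<sigma> where "\<sigma> = (\<Sum>a\<in>I. v a * M n a)"
      \<comment> \<open>For a positive pivot this value of \<open>w n\<close> minimizes the form of
        \<open>M\<close>, and the minimum is the form of the Schur complement at \<open>v\<close>;
        for a zero pivot both corrections vanish.\<close>
      define w where "w = v(n := - \<sigma> / M n n)"
      have "quad_form I M' v = quad_form I M v - (\<Sum>a\<in>I. \<Sum>b\<in>I. (v a * M n a) * (v b * M n b)) / M n n"
        by (simp add: quad_form_def M'_def sum_subtractf algebra_simps sum_divide_distrib)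
      also have "\<dots> = quad_form I M v - \<sigma>\<^sup>2 / M n n"
        by (simp add: \<sigma>_def power2_eq_square sum_product)
      also have "\<dots> = quad_form I M v + 2 * (- \<sigma> / M n n) * \<sigma> + (- \<sigma> / M n n)\<^sup>2 * M n n"
        by (cases "M n n = 0") (simp_all add: power2_eq_square field_simps)
      also have "\<dots> = quad_form (insert n I) M w"
      proof -
        have "(\<Sum>a\<in>I. w a * M n a) = \<sigma>"
          unfolding \<sigma>_def w_def using insert.hyps by (intro sum.cong) auto
        moreover have "quad_form I M w = quad_form I M v"
          unfolding w_def using insert.hyps by (intro quad_form_cong) auto
        ultimately show ?thesis by (simp add: q w_def)
      qed
      finally show "0 \<le> quad_form I M' v" using pos by simp
    qed
    then obtain V where V: "\<And>a b. a \<in> I \<Longrightarrow> b \<in> I \<Longrightarrow> M' a b = (\<Sum>c\<in>I. V c a * V c b)"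
      using insert.IH by blast
    \<comment> \<open>Row \<open>n\<close> is the pivot row over the root of the pivot; the rows of
      \<open>V\<close> get 0 in column \<open>n\<close>. For a zero pivot row \<open>n\<close>
      becomes 0, consistent with \<open>zero\<close>.\<close>
    define W where "W = (\<lambda>c a. if c = n then M n a / sqrt (M n n) else if a = n then 0 else V c a)"
    have sumW: "(\<Sum>c\<in>insert n I. W c a * W c b) =
        M n a * M n b / M n n + (\<Sum>c\<in>I. if a = n \<or> b = n then 0 else V c a * V c b)" for a b
    proof -
      have "(\<Sum>c\<in>I. W c a * W c b) = (\<Sum>c\<in>I. if a = n \<or> b = n then 0 else V c a * V c b)"
        using insert.hyps by (intro sum.cong) (auto simp: W_def)
      moreover have "W n a * W n b = M n a * M n b / M n n"
        using \<open>0 \<le> M n n\<close> by (simp add: W_def)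
      ultimately show ?thesis using insert.hyps by simp
    qed
    have "M a b = (\<Sum>c\<in>insert n I. W c a * W c b)"
      if "a \<in> insert n I" "b \<in> insert n I" for a b
    proof (cases "a = n \<or> b = n")
      case True
      then show ?thesis
        unfolding sumW using that zero sym[OF that] by (cases "M n n = 0") auto
    next
      case False
      then show ?thesis
        unfolding sumW using that V[of a b] by (simp add: M'_def)
    qed
    then show ?case by blast
  qed
  then show ?thesis using that by blast
qed

text \<open>\<open>M\<close> is the sum of the outer products of the rows of \<open>V\<close>, and
  pairing an outer product with \<open>N\<close> evaluates the form of \<open>N\<close>.\<close>

lemma frobenius_factorization:
  assumes "\<And>a b. a \<in> I \<Longrightarrow> b \<in> I \<Longrightarrow> M a b = (\<Sum>c\<in>I. V c a * V c b)"
  shows "frobenius I M N = (\<Sum>c\<in>I. quad_form I N (V c))"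
proof -
  have "frobenius I M N = (\<Sum>a\<in>I. \<Sum>b\<in>I. \<Sum>c\<in>I. V c a * N a b * V c b)"
    unfolding frobenius_def using assms by (intro sum.cong refl) (simp add: sum_distrib_left sum_distrib_right algebra_simps)
  also have "\<dots> = (\<Sum>a\<in>I. \<Sum>c\<in>I. \<Sum>b\<in>I. V c a * N a b * V c b)"
    by (intro sum.cong refl sum.swap)
  also have "\<dots> = (\<Sum>c\<in>I. quad_form I N (V c))"
    unfolding quad_form_def by (rule sum.swap)
  finally show ?thesis .
qed

text \<open>One half of the self-duality of the semidefinite cone, by factoring
  \<open>M\<close>.\<close>

lemma frobenius_psd_nonneg:
  assumes "finite I" "psd I M" "psd I N"
  shows "0 \<le> frobenius I M N"
proof -
  obtain V where "\<And>a b. a \<in> I \<Longrightarrow> b \<in> I \<Longrightarrow> M a b = (\<Sum>c\<in>I. V c a * V c b)"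
    using psd_factorization[OF assms(1,2)] by blast
  from frobenius_factorization[OF this, where N = N] show ?thesis
    using assms(3) by (simp add: psd_def sum_nonneg)
qed

text \<open>The pairing is a sum of nonnegative values of the form of \<open>N\<close>; if it is not
  positive, each value is 0 and definiteness kills every row of the factor of
  \<open>M\<close>.\<close>

lemma frobenius_posdef_nonpos_imp_zero:
  assumes "finite I" "psd I M" "posdef I N" "frobenius I M N \<le> 0" "a \<in> I" "b \<in> I"
  shows "M a b = 0"
proof -
  obtain V where V: "\<And>a b. a \<in> I \<Longrightarrow> b \<in> I \<Longrightarrow> M a b = (\<Sum>c\<in>I. V c a * V c b)"
    using psd_factorization[OF assms(1,2)] by blast
  have pos: "(\<exists>a\<in>I. v a \<noteq> 0) \<Longrightarrow> 0 < quad_form I N v" for v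
    using assms(3) by (simp add: posdef_def)
  moreover have "(\<forall>a\<in>I. v a = 0) \<Longrightarrow> quad_form I N v = 0" for v
    by (simp add: quad_form_def)
  ultimately have nonneg: "0 \<le> quad_form I N v" for v
    by (metis less_eq_real_def)
  have "(\<Sum>c\<in>I. quad_form I N (V c)) = 0"
    using frobenius_factorization[OF V, where N = N] assms(4) nonneg
    by (simp add: order_antisym sum_nonneg)
  then have "quad_form I N (V c) = 0" if "c \<in> I" for c
    using that assms(1) nonneg by (simp add: sum_nonneg_eq_0_iff)
  then have "V c a = 0" if "c \<in> I" for c
    using pos[of "V c"] that assms(5) by force
  then show ?thesis using V[OF assms(5,6)] by simp
qed

text \<open>A separating functional for the convex set of all \<open>(F(\<lambda>) - S, c \<bullet> \<lambda> - v - t)\<close>, with \<open>S\<close> ranging over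
  the (not necessarily symmetric) matrices with nonnegative quadratic form and \<open>t > 0\<close>, is a multiplier;
  \<open>None\<close> indexes the last coordinate. Admitting antisymmetric
  \<open>S\<close> forces the matrix part of the functional to be symmetric.\<close>

lemma semidefinite_duality:
  fixes E :: "'j \<Rightarrow> 'i \<Rightarrow> 'i \<Rightarrow> real"
  assumes "finite I" "finite J"
    and sym: "sym_matrix I A" "\<And>j. j \<in> J \<Longrightarrow> sym_matrix I (E j)"
    and slater: "posdef I (\<lambda>a b. A a b + (\<Sum>j\<in>J. ls j * E j a b))"
    and bound: "\<And>l. psd I (\<lambda>a b. A a b + (\<Sum>j\<in>J. l j * E j a b)) \<Longrightarrow> (\<Sum>j\<in>J. c j * l j) \<le> v"
  obtains Z where "psd I Z" "\<And>j. j \<in> J \<Longrightarrow> frobenius I Z (E j) = - c j" "frobenius I Z A \<le> v"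
proof -
  define F where "F = (\<lambda>l a b. A a b + (\<Sum>j\<in>J. l j * E j a b))"
  define C where "C = {w :: ('i \<times> 'i) option \<Rightarrow> real. \<exists>l S. (\<forall>x. 0 \<le> quad_form I S x) \<and>
    (\<forall>a b. w (Some (a, b)) = F l a b - S a b) \<and> w None < (\<Sum>j\<in>J. c j * l j) - v}"
  define K where "K = insert None (Some ` (I \<times> I))"
  have finK: "finite K" using \<open>finite I\<close> by (simp add: K_def)
  have sumK: "(\<Sum>i\<in>K. w i * x i) = w None * x None
      + frobenius I (\<lambda>a b. w (Some (a, b))) (\<lambda>a b. x (Some (a, b)))" for w x :: "('i \<times> 'i) option \<Rightarrow> real"
    using \<open>finite I\<close> by (simp add: K_def sum.reindex frobenius_def sum.cartesian_product split_def)
  have memC: "(\<lambda>i. case i of None \<Rightarrow> (\<Sum>j\<in>J. c j * l j) - v - t | Some (a, b) \<Rightarrow> F l a b - S a b) \<in> C"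
    if "\<And>x. 0 \<le> quad_form I S x" "0 < t" for l S t
    unfolding C_def using that by (intro CollectI exI[of _ l] exI[of _ S]) auto
  have F_sym: "sym_matrix I (F l)" for l
    using sym unfolding F_def sym_matrix_def by (auto intro!: arg_cong2[where f = "(+)"] sum.cong)
  have "\<exists>w. (\<exists>i\<in>K. w i \<noteq> 0) \<and> (\<forall>x\<in>C. 0 \<le> (\<Sum>i\<in>K. w i * x i))"
  proof (rule separation_from_zero[OF finK])
    show "C \<noteq> {}" using memC[of "\<lambda>_ _. 0" 1] by (auto simp: quad_form_def)
  next
    fix w w' u u'
    assume w: "w \<in> C" "w' \<in> C" and u: "0 \<le> u" "0 \<le> u'" "u + u' = (1::real)"
    from w obtain l S l' S' where
      S: "\<And>x. 0 \<le> quad_form I S x" "\<And>a b. w (Some (a, b)) = F l a b - S a b" "w None < (\<Sum>j\<in>J. c j * l j) - v" and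
      S': "\<And>x. 0 \<le> quad_form I S' x" "\<And>a b. w' (Some (a, b)) = F l' a b - S' a b" "w' None < (\<Sum>j\<in>J. c j * l' j) - v"
      unfolding C_def by blast
    \<comment> \<open>\<open>F\<close> is affine, not linear: its constant part \<open>A\<close>,
      like the constant \<open>v\<close>, is preserved because the weights add up to 1.\<close>
    have u': "u' = 1 - u" using u by simp
    show "(\<lambda>i. u * w i + u' * w' i) \<in> C"
      unfolding C_def
    proof (intro CollectI exI[of _ "\<lambda>j. u * l j + u' * l' j"] exI[of _ "\<lambda>a b. u * S a b + u' * S' a b"] conjI allI)
      fix x
      have "quad_form I (\<lambda>a b. u * S a b + u' * S' a b) x = u * quad_form I S x + u' * quad_form I S' x"
        by (simp add: quad_form_def sum.distrib sum_distrib_left algebra_simps)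
      then show "0 \<le> quad_form I (\<lambda>a b. u * S a b + u' * S' a b) x"
        using S(1) S'(1) u by simp
    next
      fix a b
      have "F (\<lambda>j. u * l j + u' * l' j) a b = u * F l a b + u' * F l' a b"
        by (simp add: F_def u' sum.distrib sum_distrib_left sum_subtractf algebra_simps)
      then show "u * w (Some (a, b)) + u' * w' (Some (a, b))
          = F (\<lambda>j. u * l j + u' * l' j) a b - (u * S a b + u' * S' a b)"
        by (simp add: S(2) S'(2) algebra_simps)
    next
      have "u * w None + u' * w' None < u * ((\<Sum>j\<in>J. c j * l j) - v) + u' * ((\<Sum>j\<in>J. c j * l' j) - v)"
      proof (cases "u = 0")
        case True
        then show ?thesis using u S'(3) by simp
      next
        case False
        then show ?thesis using u S(3) S'(3)
          by (intro add_less_le_mono mult_strict_left_mono mult_left_mono) auto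
      qed
      also have "\<dots> = (\<Sum>j\<in>J. c j * (u * l j + u' * l' j)) - v"
        by (simp add: u' sum.distrib sum_distrib_left sum_subtractf algebra_simps)
      finally show "u * w None + u' * w' None < (\<Sum>j\<in>J. c j * (u * l j + u' * l' j)) - v" .
    qed
  next
    fix w
    assume "w \<in> C"
    then obtain l S where
      S: "\<And>x. 0 \<le> quad_form I S x" "\<And>a b. w (Some (a, b)) = F l a b - S a b" "w None < (\<Sum>j\<in>J. c j * l j) - v"
      unfolding C_def by blast
    show "\<exists>i\<in>K. w i \<noteq> 0"
    proof (rule ccontr)
      assume "\<not> (\<exists>i\<in>K. w i \<noteq> 0)"
      \<comment> \<open>A point vanishing on \<open>K\<close> would make \<open>F l\<close> agree
        with \<open>S\<close> on \<open>I\<close>, hence be semidefinite, with objective above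
        \<open>v\<close>, against \<open>bound\<close>.\<close>
      then have 0: "w None = 0" "\<And>a b. a \<in> I \<Longrightarrow> b \<in> I \<Longrightarrow> F l a b = S a b"
        using S(2) by (auto simp: K_def)
      then have "quad_form I (F l) x = quad_form I S x" for x
        by (simp add: quad_form_def cong: sum.cong)
      then have "psd I (F l)" using S(1) F_sym by (simp add: psd_def)
      then show False using bound[of l] S(3) 0(1) by (simp add: F_def)
    qed
  qed
  then obtain w where w0: "\<exists>i\<in>K. w i \<noteq> 0" and w: "\<And>x. x \<in> C \<Longrightarrow> 0 \<le> (\<Sum>i\<in>K. w i * x i)"
    by blast
  define Z where "Z = (\<lambda>a b. - w (Some (a, b)))"
  define \<tau> where "\<tau> = - w None"
  have Zw: "frobenius I (\<lambda>a b. w (Some (a, b))) N = - frobenius I Z N" for N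
    by (simp add: Z_def frobenius_def sum_negf)
  have ineq: "0 \<le> frobenius I Z S - frobenius I Z (F l) - \<tau> * ((\<Sum>j\<in>J. c j * l j) - v - t)"
    if "\<And>x. 0 \<le> quad_form I S x" "0 < t" for l S t
    using w[OF memC[OF that, of l]] by (simp add: sumK Zw frobenius_linear \<tau>_def)
  have quad0: "quad_form I (\<lambda>_ _. 0) x = 0" for x
    by (simp add: quad_form_def)
  have frob0: "frobenius I Z (\<lambda>_ _. 0) = 0"
    by (simp add: frobenius_def)
  \<comment> \<open>\<open>S\<close> may be scaled by arbitrarily large \<open>t\<close>, so its
    pairing with \<open>Z\<close> cannot be negative.\<close>
  have dual_cone: "0 \<le> frobenius I Z S" if "\<And>x. 0 \<le> quad_form I S x" for S
  proof -
    have "0 \<le> (- frobenius I Z (F ls) - \<tau> * ((\<Sum>j\<in>J. c j * ls j) - v - 1)) - t * (- frobenius I Z S)"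
      if "0 < t" for t
    proof -
      have "quad_form I (\<lambda>a b. t * S a b) x = t * quad_form I S x" for x
        by (simp add: quad_form_def sum_distrib_left algebra_simps)
      then have "0 \<le> quad_form I (\<lambda>a b. t * S a b) x" for x
        using \<open>\<And>x. 0 \<le> quad_form I S x\<close> that by simp
      from ineq[OF this, of 1 ls] show ?thesis by (simp add: frobenius_linear)
    qed
    then have "- frobenius I Z S \<le> 0" by (rule affine_nonneg_imp_slope_nonpos)
    then show ?thesis by simp
  qed
  have "0 \<le> \<tau>"
  proof -
    have "0 \<le> (- frobenius I Z (F ls) - \<tau> * ((\<Sum>j\<in>J. c j * ls j) - v)) - t * (- \<tau>)" if "0 < t" for t
      using ineq[of "\<lambda>_ _. 0" t ls] that by (simp add: quad0 frob0 algebra_simps)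
    then have "- \<tau> \<le> 0" by (rule affine_nonneg_imp_slope_nonpos)
    then show ?thesis by simp
  qed
  have main: "frobenius I Z (F l) + \<tau> * ((\<Sum>j\<in>J. c j * l j) - v) \<le> 0" for l
  proof (rule field_le_epsilon)
    fix e :: real
    assume "0 < e"
    \<comment> \<open>The gap shrinks to 0 with \<open>e\<close>; the divisor
      \<open>\<tau> + 1\<close> stays positive even for \<open>\<tau> = 0\<close>.\<close>
    then have t: "0 < e / (\<tau> + 1)" using \<open>0 \<le> \<tau>\<close> by simp
    have "\<tau> * (e / (\<tau> + 1)) \<le> e"
      using \<open>0 \<le> \<tau>\<close> \<open>0 < e\<close> by (simp add: field_simps)
    then show "frobenius I Z (F l) + \<tau> * ((\<Sum>j\<in>J. c j * l j) - v) \<le> 0 + e"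
      using ineq[of "\<lambda>_ _. 0", OF _ t, of l] by (simp add: quad0 frob0 algebra_simps)
  qed
  have frobF: "frobenius I Z (F l) = frobenius I Z A + (\<Sum>j\<in>J. l j * frobenius I Z (E j))" for l
    by (simp add: F_def frobenius_linear)
  have ZA: "frobenius I Z A \<le> \<tau> * v"
    using main[of "\<lambda>_. 0"] by (simp add: frobF algebra_simps)
  have ZE: "frobenius I Z (E j) = - \<tau> * c j" if "j \<in> J" for j
  proof -
    \<comment> \<open>\<open>l\<close> runs through all real multiples of the unit vector of
      \<open>j\<close>; an affine function that stays nonnegative has slope 0.\<close>
    have "0 \<le> (\<tau> * v - frobenius I Z A) + t * (- frobenius I Z (E j) - \<tau> * c j)" for t
      using main[of "\<lambda>i. if i = j then t else 0"] \<open>finite J\<close> that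
      by (simp add: frobF if_distrib if_distribR sum.delta algebra_simps cong: if_cong)
    then have "- frobenius I Z (E j) - \<tau> * c j = 0" by (rule affine_nonneg_imp_slope_zero)
    then show ?thesis by simp
  qed
  have "psd I Z"
    unfolding psd_def
  proof (intro conjI allI)
    fix x
    \<comment> \<open>Outer products are admissible choices of \<open>S\<close>; their pairing with
      \<open>Z\<close> is its quadratic form.\<close>
    have "0 \<le> quad_form I (\<lambda>a b. x a * x b) y" for y
    proof -
      have "quad_form I (\<lambda>a b. x a * x b) y = (\<Sum>a\<in>I. x a * y a)\<^sup>2"
        by (simp add: quad_form_def power2_eq_square sum_product algebra_simps)
      then show ?thesis by simp
    qed
    from dual_cone[OF this] show "0 \<le> quad_form I Z x" by (simp add: frobenius_outer)
  next
    \<comment> \<open>Antisymmetric matrices have zero form and are thus admissible; a matrix unit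
      minus its transpose compares \<open>Z a b\<close> with \<open>Z b a\<close>.\<close>
    have anti: "quad_form I (\<lambda>a b. N a b - N b a) x = 0" for N x
    proof -
      have "(\<Sum>a\<in>I. \<Sum>b\<in>I. x a * N b a * x b) = (\<Sum>a\<in>I. \<Sum>b\<in>I. x a * N a b * x b)"
        by (subst sum.swap) (simp add: algebra_simps)
      then show ?thesis
        by (simp add: quad_form_def sum_subtractf algebra_simps)
    qed
    have Z_le: "Z b a \<le> Z a b" if "a \<in> I" "b \<in> I" for a b
    proof -
      define N where "N = (\<lambda>a' b'. if a' = a then if b' = b then 1 else 0 else 0 :: real)"
      have "0 \<le> frobenius I Z (\<lambda>a b. N a b - N b a)"
        by (rule dual_cone) (simp add: anti)
      moreover have "frobenius I Z N = Z a b"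
      proof -
        have "frobenius I Z N = (\<Sum>a'\<in>I. \<Sum>b'\<in>I. if a' = a then if b' = b then Z a' b' else 0 else 0)"
          unfolding frobenius_def N_def by (intro sum.cong refl) auto
        also have "\<dots> = (\<Sum>a'\<in>I. if a' = a then Z a' b else 0)"
          using that \<open>finite I\<close> by (intro sum.cong refl) auto
        finally show ?thesis using that \<open>finite I\<close> by (simp add: sum.delta)
      qed
      moreover have "frobenius I Z (\<lambda>a b. N b a) = Z b a"
      proof -
        have "frobenius I Z (\<lambda>a b. N b a) = (\<Sum>a'\<in>I. \<Sum>b'\<in>I. if a' = b then if b' = a then Z a' b' else 0 else 0)"
          unfolding frobenius_def N_def by (intro sum.cong refl) auto
        also have "\<dots> = (\<Sum>a'\<in>I. if a' = b then Z a' a else 0)"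
          using that \<open>finite I\<close> by (intro sum.cong refl) auto
        finally show ?thesis using that \<open>finite I\<close> by (simp add: sum.delta)
      qed
      ultimately show ?thesis by (simp add: frobenius_linear)
    qed
    then show "sym_matrix I Z" unfolding sym_matrix_def by (meson order_antisym)
  qed
  \<comment> \<open>Strict feasibility enters here: for \<open>\<tau> = 0\<close>, \<open>Z\<close>
    would pair nonpositively with the positive definite \<open>F ls\<close>, so the whole functional
    would vanish on \<open>K\<close>.\<close>
  have "\<tau> \<noteq> 0"
  proof
    assume "\<tau> = 0"
    then have "frobenius I Z (F ls) \<le> 0" using main[of ls] by simp
    then have "Z a b = 0" if "a \<in> I" "b \<in> I" for a b
      using frobenius_posdef_nonpos_imp_zero[OF \<open>finite I\<close> \<open>psd I Z\<close>] slater that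
      unfolding F_def by blast
    then show False using w0 \<open>\<tau> = 0\<close> by (auto simp: K_def Z_def \<tau>_def)
  qed
  then have "0 < \<tau>" using \<open>0 \<le> \<tau>\<close> by simp
  show ?thesis
  proof (rule that)
    have "quad_form I (\<lambda>a b. (1 / \<tau>) * Z a b) x = (1 / \<tau>) * quad_form I Z x" for x
      unfolding quad_form_def sum_distrib_left by (intro sum.cong refl) simp
    then show "psd I (\<lambda>a b. (1 / \<tau>) * Z a b)"
      using \<open>psd I Z\<close> \<open>0 < \<tau>\<close> by (simp add: psd_def sym_matrix_def)
    show "frobenius I (\<lambda>a b. (1 / \<tau>) * Z a b) (E j) = - c j" if "j \<in> J" for j
      using ZE[OF that] \<open>\<tau> \<noteq> 0\<close> by (simp only: frobenius_scale_left) simp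
    show "frobenius I (\<lambda>a b. (1 / \<tau>) * Z a b) A \<le> v"
      using ZA \<open>0 < \<tau>\<close> by (simp only: frobenius_scale_left) (simp add: field_simps)
  qed
qed

subsection \<open>Polynomials and moments\<close>

text \<open>These are the moments of the point mass at \<open>x\<close>.\<close>

definition moments :: "real ^ ('v::finite) \<Rightarrow> 'v midx \<Rightarrow> real" where
  "moments x \<alpha> = (\<Prod>k\<in>UNIV. (x $ k) ^ Poly_Mapping.lookup \<alpha> k)"

lemma moments_add: "moments x (\<alpha> + \<beta>) = moments x \<alpha> * moments x \<beta>"
  by (simp add: moments_def lookup_add power_add prod.distrib)

lemma moments_zero [simp]: "moments x 0 = 1"
  by (simp add: moments_def)

lemma moments_scaleR: "moments (t *\<^sub>R x) \<alpha> = t ^ mdeg \<alpha> * moments x \<alpha>"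
  by (simp add: moments_def mdeg_def power_mult_distrib prod.distrib power_sum)

lemma mdeg_add: "mdeg (\<alpha> + \<beta>) = mdeg \<alpha> + mdeg \<beta>"
  by (simp add: mdeg_def lookup_add sum.distrib)

lemma mdeg_zero [simp]: "mdeg 0 = 0"
  by (simp add: mdeg_def)

lemma mdeg_single [simp]: "mdeg (Poly_Mapping.single a n) = n"
  by (simp add: mdeg_def lookup_single when_def)

lemma peval_superset:
  assumes "finite S" "Poly_Mapping.keys u \<subseteq> S"
  shows "peval u x = (\<Sum>\<alpha>\<in>S. Poly_Mapping.lookup u \<alpha> * moments x \<alpha>)"
  unfolding peval_def moments_def
  by (rule sum.mono_neutral_left) (use assms in \<open>auto simp: in_keys_iff\<close>)

lemma peval_add [simp]: "peval (u + v) x = peval u x + peval v x"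
proof -
  define S where "S = Poly_Mapping.keys u \<union> Poly_Mapping.keys v"
  have "finite S" "Poly_Mapping.keys u \<subseteq> S" "Poly_Mapping.keys v \<subseteq> S" "Poly_Mapping.keys (u + v) \<subseteq> S"
    using keys_add[of u v] by (auto simp: S_def)
  then show ?thesis
    by (simp add: peval_superset[of S] lookup_add sum.distrib algebra_simps)
qed

lemma peval_single [simp]: "peval (Poly_Mapping.single \<alpha> c) x = c * moments x \<alpha>"
  by (subst peval_superset[of "{\<alpha>}"]) auto

lemma peval_zero [simp]: "peval 0 x = 0"
  by (simp add: peval_def)

lemma peval_one [simp]: "peval 1 x = 1"
  using peval_single[of 0 1 x] by simp

lemma peval_uminus [simp]: "peval (- u) x = - peval u x"
  by (simp add: peval_def sum_negf)

lemma peval_diff [simp]: "peval (u - v) x = peval u x - peval v x"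
  using peval_add[of u "- v" x] by simp

lemma peval_sum [simp]: "peval (\<Sum>i\<in>I. u i) x = (\<Sum>i\<in>I. peval (u i) x)"
  by (induction I rule: infinite_finite_induct) auto

lemma mpoly_sum_of_terms:
  assumes "finite S" "Poly_Mapping.keys u \<subseteq> S"
  shows "u = (\<Sum>\<alpha>\<in>S. Poly_Mapping.single \<alpha> (Poly_Mapping.lookup u \<alpha>))"
  by (rule poly_mapping_eqI)
    (use assms in \<open>auto simp: lookup_sum lookup_single when_def sum.delta in_keys_iff\<close>)

lemma mpoly_times_sum_of_terms:
  assumes "finite S" "Poly_Mapping.keys u \<subseteq> S" "finite T" "Poly_Mapping.keys v \<subseteq> T"
  shows "u * v = (\<Sum>\<alpha>\<in>S. \<Sum>\<beta>\<in>T.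
    Poly_Mapping.single (\<alpha> + \<beta>) (Poly_Mapping.lookup u \<alpha> * Poly_Mapping.lookup v \<beta>))"
proof -
  have "u * v = (\<Sum>\<alpha>\<in>S. Poly_Mapping.single \<alpha> (Poly_Mapping.lookup u \<alpha>)) *
      (\<Sum>\<beta>\<in>T. Poly_Mapping.single \<beta> (Poly_Mapping.lookup v \<beta>))"
    using mpoly_sum_of_terms[OF assms(1,2)] mpoly_sum_of_terms[OF assms(3,4)] by simp
  then show ?thesis by (simp add: sum_product mult_single)
qed

lemma peval_mult [simp]: "peval (u * v) x = peval u x * peval v x"
proof -
  have "peval (u * v) x = (\<Sum>\<alpha>\<in>Poly_Mapping.keys u. \<Sum>\<beta>\<in>Poly_Mapping.keys v.
      (Poly_Mapping.lookup u \<alpha> * moments x \<alpha>) * (Poly_Mapping.lookup v \<beta> * moments x \<beta>))"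
    by (subst mpoly_times_sum_of_terms[OF finite_keys order_refl finite_keys order_refl])
      (simp add: moments_add algebra_simps)
  then show ?thesis
    by (simp add: sum_product[symmetric] peval_superset[OF finite_keys order_refl])
qed

lemma peval_power [simp]: "peval (u ^ n) x = peval u x ^ n"
  by (induction n) auto

lemma peval_prod [simp]: "peval (\<Prod>i\<in>I. u i) x = (\<Prod>i\<in>I. peval (u i) x)"
  by (induction I rule: infinite_finite_induct) auto

lemma peval_pconst [simp]: "peval (pconst c) x = c"
  by (simp add: pconst_def)

lemma peval_pvar [simp]: "peval (pvar a) x = x $ a"
proof -
  have "moments x (Poly_Mapping.single a 1) = (\<Prod>k\<in>UNIV. if k = a then x $ k else 1)"
    unfolding moments_def by (intro prod.cong) (auto simp: lookup_single when_def)
  then show ?thesis by (simp add: pvar_def)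
qed

lemma lookup_pconst_mult:
  "Poly_Mapping.lookup (pconst c * u) \<alpha> = c * Poly_Mapping.lookup u \<alpha>"
  unfolding pconst_def by (simp flip: mult_map_scale_conv_mult add: map.rep_eq when_def)

text \<open>Induction on the set \<open>V\<close> of variables that actually vary: collecting powers of one variable
  turns the hypothesis into the vanishing of a univariate polynomial.\<close>

lemma monomials_linear_independent:
  fixes c :: "'v midx \<Rightarrow> real"
  assumes "finite V" "finite S"
    and "\<And>x :: 'v \<Rightarrow> real. (\<Sum>\<alpha>\<in>S. c \<alpha> * (\<Prod>k\<in>V. x k ^ Poly_Mapping.lookup \<alpha> k)) = 0"
    and "\<And>\<alpha> \<beta>. \<lbrakk>\<alpha> \<in> S; \<beta> \<in> S; \<And>k. k \<in> V \<Longrightarrow> Poly_Mapping.lookup \<alpha> k = Poly_Mapping.lookup \<beta> k\<rbrakk> \<Longrightarrow> \<alpha> = \<beta>"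
    and "\<alpha> \<in> S"
  shows "c \<alpha> = 0"
  using assms
proof (induction V arbitrary: S rule: finite_induct)
  case empty
  then have "S = {\<alpha>}" by blast
  then show ?case using empty.prems(2) by simp
next
  case (insert n V)
  \<comment> \<open>A bound on the exponents of \<open>n\<close>, so that collecting its powers
    gives one univariate polynomial, with coefficients \<open>e j\<close>.\<close>
  define N where "N = Max ((\<lambda>\<alpha>. Poly_Mapping.lookup \<alpha> n) ` S)"
  have N: "Poly_Mapping.lookup \<beta> n \<le> N" if "\<beta> \<in> S" for \<beta>
    unfolding N_def using insert.prems(1) that by (intro Max_ge) auto
  \<comment> \<open>On the fibre of \<open>\<alpha>\<close> the exponents of \<open>n\<close> agree,
    so those on \<open>V\<close> still tell the multi-indices apart.\<close>
  define S' where "S' = {\<beta> \<in> S. Poly_Mapping.lookup \<beta> n = Poly_Mapping.lookup \<alpha> n}"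
  show ?case
  proof (rule insert.IH)
    show "finite S'" "\<alpha> \<in> S'"
      using insert.prems by (auto simp: S'_def)
    show "\<beta> = \<gamma>" if "\<beta> \<in> S'" "\<gamma> \<in> S'"
      "\<And>k. k \<in> V \<Longrightarrow> Poly_Mapping.lookup \<beta> k = Poly_Mapping.lookup \<gamma> k" for \<beta> \<gamma>
      using that by (intro insert.prems(3)) (auto simp: S'_def)
    fix x :: "'v \<Rightarrow> real"
    define e where "e = (\<lambda>j. \<Sum>\<beta>\<in>{\<beta> \<in> S. Poly_Mapping.lookup \<beta> n = j}.
      c \<beta> * (\<Prod>k\<in>V. x k ^ Poly_Mapping.lookup \<beta> k))"
    have "(\<Sum>j\<le>N. e j * t ^ j) = 0" for t
    proof -
      have "(\<Sum>j\<le>N. e j * t ^ j) = (\<Sum>j\<le>N. \<Sum>\<beta>\<in>{\<beta> \<in> S. Poly_Mapping.lookup \<beta> n = j}.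
          c \<beta> * (t ^ Poly_Mapping.lookup \<beta> n * (\<Prod>k\<in>V. x k ^ Poly_Mapping.lookup \<beta> k)))"
        unfolding e_def sum_distrib_right by (intro sum.cong refl) simp
      also have "\<dots> = (\<Sum>\<beta>\<in>S. c \<beta> * (t ^ Poly_Mapping.lookup \<beta> n * (\<Prod>k\<in>V. x k ^ Poly_Mapping.lookup \<beta> k)))"
        using insert.prems(1) N by (intro sum.group) auto
      also have "\<dots> = (\<Sum>\<beta>\<in>S. c \<beta> * (\<Prod>k\<in>insert n V. (x(n := t)) k ^ Poly_Mapping.lookup \<beta> k))"
      proof (intro sum.cong refl)
        fix \<beta>
        have "(\<Prod>k\<in>V. (x(n := t)) k ^ Poly_Mapping.lookup \<beta> k) = (\<Prod>k\<in>V. x k ^ Poly_Mapping.lookup \<beta> k)"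
          using insert.hyps by (intro prod.cong) auto
        then show "c \<beta> * (t ^ Poly_Mapping.lookup \<beta> n * (\<Prod>k\<in>V. x k ^ Poly_Mapping.lookup \<beta> k)) =
            c \<beta> * (\<Prod>k\<in>insert n V. (x(n := t)) k ^ Poly_Mapping.lookup \<beta> k)"
          unfolding prod.insert[OF insert.hyps] by (simp only: fun_upd_same)
      qed
      also have "\<dots> = 0" by (rule insert.prems(2))
      finally show ?thesis .
    qed
    then have "\<forall>j\<le>N. e j = 0" using polyfun_eq_0[of e N] by blast
    then have "e (Poly_Mapping.lookup \<alpha> n) = 0" using N insert.prems(4) by blast
    then show "(\<Sum>\<beta>\<in>S'. c \<beta> * (\<Prod>k\<in>V. x k ^ Poly_Mapping.lookup \<beta> k)) = 0"
      by (simp add: e_def S'_def)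
  qed
qed

lemma moments_linear_independent:
  fixes S :: "('v::finite) midx set"
  assumes "finite S" "\<And>x. (\<Sum>\<alpha>\<in>S. c \<alpha> * moments x \<alpha>) = 0" "\<alpha> \<in> S"
  shows "c \<alpha> = 0"
proof (rule monomials_linear_independent[OF finite assms(1) _ _ assms(3)])
  show "(\<Sum>\<alpha>\<in>S. c \<alpha> * (\<Prod>k\<in>UNIV. x k ^ Poly_Mapping.lookup \<alpha> k)) = 0" for x
    using assms(2)[of "vec_lambda x"] by (simp add: moments_def)
qed (auto intro: poly_mapping_eqI)

text \<open>Turns an identity of values, the form in which \<open>sos_convex\<close> gives its
  certificate, into an identity of coefficients.\<close>

lemma peval_injective:
  assumes "\<And>x. peval u x = peval v x"
  shows "u = v"
proof -
  have "Poly_Mapping.lookup (u - v) \<alpha> = 0" if "\<alpha> \<in> Poly_Mapping.keys (u - v)" for \<alpha>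
  proof (rule moments_linear_independent[OF finite_keys _ that])
    show "(\<Sum>\<alpha>\<in>Poly_Mapping.keys (u - v). Poly_Mapping.lookup (u - v) \<alpha> * moments x \<alpha>) = 0" for x
      using assms[of x] by (simp flip: peval_superset)
  qed
  then have "u - v = 0" by (metis in_keys_iff keys_eq_empty ex_in_conv)
  then show ?thesis by simp
qed

section \<open>Degrees and leading forms\<close>

lemma poly_deg_le_iff: "poly_deg_le u r \<longleftrightarrow> (\<forall>\<alpha>. Poly_Mapping.lookup u \<alpha> \<noteq> 0 \<longrightarrow> mdeg \<alpha> \<le> r)"
  by (auto simp: poly_deg_le_def midx_upto_def in_keys_iff)

lemma poly_deg_le_add: "poly_deg_le u r \<Longrightarrow> poly_deg_le v r \<Longrightarrow> poly_deg_le (u + v) r"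
  using keys_add[of u v] by (auto simp: poly_deg_le_def)

lemma poly_deg_le_diff: "poly_deg_le u r \<Longrightarrow> poly_deg_le v r \<Longrightarrow> poly_deg_le (u - v) r"
  using keys_diff[of u v] by (auto simp: poly_deg_le_def)

lemma poly_deg_le_sum: "(\<And>i. i \<in> I \<Longrightarrow> poly_deg_le (u i) r) \<Longrightarrow> poly_deg_le (\<Sum>i\<in>I. u i) r"
proof (induction I rule: infinite_finite_induct)
  case (insert i I)
  then show ?case by (simp add: poly_deg_le_add)
qed (simp_all add: poly_deg_le_def)

lemma poly_deg_le_pconst: "poly_deg_le (pconst c) r"
  by (auto simp: poly_deg_le_iff pconst_def lookup_single when_def)

lemma poly_deg_le_pvar: "1 \<le> r \<Longrightarrow> poly_deg_le (pvar a) r"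
  by (auto simp: poly_deg_le_iff pvar_def lookup_single when_def)

lemma poly_deg_le_pconst_mult: "poly_deg_le u r \<Longrightarrow> poly_deg_le (pconst c * u) r"
  by (auto simp: poly_deg_le_iff lookup_pconst_mult)

text \<open>Along a ray a term is scaled by \<open>t\<close> to the power of its degree; after
  division by \<open>t ^ D\<close> only the form of degree \<open>D\<close> survives in the
  limit.\<close>

lemma peval_ray_leading_part:
  assumes "poly_deg_le u D"
  shows "((\<lambda>t. peval u (t *\<^sub>R x) / t ^ D) \<longlongrightarrow>
    (\<Sum>\<alpha>\<in>Poly_Mapping.keys u. (if mdeg \<alpha> = D then Poly_Mapping.lookup u \<alpha> else 0) * moments x \<alpha>)) at_top"
proof -
  have "((\<lambda>t. t ^ mdeg \<alpha> / t ^ D) \<longlongrightarrow> (if mdeg \<alpha> = D then 1 else 0 :: real)) at_top"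
    if "\<alpha> \<in> Poly_Mapping.keys u" for \<alpha>
  proof (cases "mdeg \<alpha> = D")
    case True
    then show ?thesis
      by (auto intro!: tendsto_eventually eventually_mono[OF eventually_gt_at_top[of 0]])
  next
    case False
    then have less: "mdeg \<alpha> < D"
      using assms that by (force simp: poly_deg_le_def midx_upto_def)
    have "eventually (\<lambda>t::real. inverse (t ^ (D - mdeg \<alpha>)) = t ^ mdeg \<alpha> / t ^ D) at_top"
      using eventually_gt_at_top[of 0]
      by eventually_elim (use less in \<open>simp add: power_diff field_simps\<close>)
    moreover have "((\<lambda>t::real. inverse (t ^ (D - mdeg \<alpha>))) \<longlongrightarrow> 0) at_top"
      using less by (intro tendsto_inverse_0_at_top filterlim_pow_at_top filterlim_ident) auto
    ultimately show ?thesis using False by (simp add: tendsto_cong)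
  qed
  then have "((\<lambda>t. \<Sum>\<alpha>\<in>Poly_Mapping.keys u. Poly_Mapping.lookup u \<alpha> * moments x \<alpha> * (t ^ mdeg \<alpha> / t ^ D)) \<longlongrightarrow>
      (\<Sum>\<alpha>\<in>Poly_Mapping.keys u. Poly_Mapping.lookup u \<alpha> * moments x \<alpha> * (if mdeg \<alpha> = D then 1 else 0))) at_top"
    by (intro tendsto_sum tendsto_mult tendsto_const)
  moreover have "(\<Sum>\<alpha>\<in>Poly_Mapping.keys u. Poly_Mapping.lookup u \<alpha> * moments x \<alpha> * (t ^ mdeg \<alpha> / t ^ D))
      = peval u (t *\<^sub>R x) / t ^ D" for t
    by (simp add: peval_superset[OF finite_keys order_refl] moments_scaleR sum_divide_distrib algebra_simps)
  moreover have "(\<Sum>\<alpha>\<in>Poly_Mapping.keys u. Poly_Mapping.lookup u \<alpha> * moments x \<alpha> * (if mdeg \<alpha> = D then 1 else 0))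
      = (\<Sum>\<alpha>\<in>Poly_Mapping.keys u. (if mdeg \<alpha> = D then Poly_Mapping.lookup u \<alpha> else 0) * moments x \<alpha>)"
    by (intro sum.cong) auto
  ultimately show ?thesis by simp
qed

text \<open>The leading forms of real squares cannot cancel: along each ray the largest one would dominate
  the sum.\<close>

lemma poly_deg_le_of_sum_of_squares:
  fixes N :: nat
  assumes deg: "poly_deg_le (\<Sum>i<N. (q i)\<^sup>2) d" and "i < N"
  shows "poly_deg_le (q i) (d div 2)"
proof (rule ccontr)
  assume "\<not> poly_deg_le (q i) (d div 2)"
  then obtain \<alpha>0 where \<alpha>0: "\<alpha>0 \<in> Poly_Mapping.keys (q i)" "d div 2 < mdeg \<alpha>0"
    by (auto simp: poly_deg_le_def midx_upto_def not_le subset_iff)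
  define K where "K = mdeg ` (\<Union>j<N. Poly_Mapping.keys (q j))"
  have "finite K" unfolding K_def by (intro finite_imageI finite_UN_I finite_lessThan finite_keys)
  have "mdeg \<alpha>0 \<in> K" using \<alpha>0 \<open>i < N\<close> by (auto simp: K_def)
  define D where "D = Max K"
  have "D \<in> K" unfolding D_def using \<open>finite K\<close> \<open>mdeg \<alpha>0 \<in> K\<close> by (intro Max_in) auto
  then obtain j \<alpha> where j: "j < N" and \<alpha>: "\<alpha> \<in> Poly_Mapping.keys (q j)" "mdeg \<alpha> = D"
    by (auto simp: K_def)
  have "mdeg \<alpha>0 \<le> D" unfolding D_def using \<open>finite K\<close> \<open>mdeg \<alpha>0 \<in> K\<close> by simp
  \<comment> \<open>The integer \<open>D\<close> exceeds \<open>d div 2\<close>, so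
    \<open>2 * D\<close> exceeds \<open>d\<close> for even and odd \<open>d\<close> alike.\<close>
  then have D: "d < 2 * D" using \<alpha>0(2) by linarith
  have deg_q: "poly_deg_le (q j) D"
  proof -
    have "mdeg \<beta> \<le> D" if "\<beta> \<in> Poly_Mapping.keys (q j)" for \<beta>
      unfolding D_def using \<open>finite K\<close> that j by (intro Max_ge) (auto simp: K_def)
    then show ?thesis by (auto simp: poly_deg_le_def midx_upto_def)
  qed
  define u where "u = (\<Sum>i<N. (q i)\<^sup>2)"
  have deg_u: "poly_deg_le u (2 * D)"
    using deg D by (auto simp: u_def poly_deg_le_def midx_upto_def)
  have u0: "(\<Sum>\<alpha>\<in>Poly_Mapping.keys u. (if mdeg \<alpha> = 2 * D then Poly_Mapping.lookup u \<alpha> else 0) * moments x \<alpha>) = 0" for x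
    using deg D by (intro sum.neutral) (auto simp: u_def poly_deg_le_def midx_upto_def)
  \<comment> \<open>The leading form of a polynomial attaining the maximal degree \<open>D\<close>.
    Its square is dominated in the limit by the part of degree \<open>2 * D\<close> of the sum,
    which is 0.\<close>
  define Q where "Q = (\<lambda>x. \<Sum>\<alpha>\<in>Poly_Mapping.keys (q j). (if mdeg \<alpha> = D then Poly_Mapping.lookup (q j) \<alpha> else 0) * moments x \<alpha>)"
  have "Q x = 0" for x
  proof -
    have "((\<lambda>t. (peval (q j) (t *\<^sub>R x) / t ^ D)\<^sup>2) \<longlongrightarrow> (Q x)\<^sup>2) at_top"
      unfolding Q_def by (intro tendsto_power peval_ray_leading_part deg_q)
    moreover have "((\<lambda>t. peval u (t *\<^sub>R x) / t ^ (2 * D)) \<longlongrightarrow> 0) at_top"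
      using peval_ray_leading_part[OF deg_u, of x] by (simp add: u0)
    moreover have "eventually (\<lambda>t. (peval (q j) (t *\<^sub>R x) / t ^ D)\<^sup>2 \<le> peval u (t *\<^sub>R x) / t ^ (2 * D)) at_top"
    proof (intro always_eventually allI)
      fix t
      have "(peval (q j) (t *\<^sub>R x))\<^sup>2 \<le> peval u (t *\<^sub>R x)"
        unfolding u_def peval_sum peval_power using j by (intro member_le_sum) auto
      then have "(peval (q j) (t *\<^sub>R x))\<^sup>2 / t ^ (2 * D) \<le> peval u (t *\<^sub>R x) / t ^ (2 * D)"
        by (intro divide_right_mono) (auto simp: power_mult)
      then show "(peval (q j) (t *\<^sub>R x) / t ^ D)\<^sup>2 \<le> peval u (t *\<^sub>R x) / t ^ (2 * D)"
        by (simp add: power_divide power_mult mult.commute flip: power_mult)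
    qed
    ultimately have "(Q x)\<^sup>2 \<le> 0"
      by (intro tendsto_le[OF trivial_limit_at_top_linorder])
    then show ?thesis by simp
  qed
  then have "(if mdeg \<alpha> = D then Poly_Mapping.lookup (q j) \<alpha> else 0) = 0"
    unfolding Q_def by (rule moments_linear_independent[OF finite_keys _ \<alpha>(1)])
  then show False using \<alpha> by (simp add: in_keys_iff)
qed

section \<open>The Riesz functional\<close>

lemma riesz_add: "riesz d y (u + v) = riesz d y u + riesz d y v"
  by (simp add: riesz_def lookup_add sum.distrib algebra_simps)

lemma riesz_diff: "riesz d y (u - v) = riesz d y u - riesz d y v"
  by (simp add: riesz_def lookup_minus sum_subtractf algebra_simps)

lemma riesz_sum: "riesz d y (\<Sum>i\<in>I. u i) = (\<Sum>i\<in>I. riesz d y (u i))"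
proof (induction I rule: infinite_finite_induct)
  case (insert i I)
  then show ?case by (simp add: riesz_add)
qed (simp_all add: riesz_def)

lemma riesz_pconst_mult: "riesz d y (pconst c * u) = c * riesz d y u"
  unfolding riesz_def lookup_pconst_mult sum_distrib_left by (simp add: mult.assoc)

lemma riesz_single:
  assumes "mdeg \<alpha> \<le> d"
  shows "riesz d y (Poly_Mapping.single \<alpha> c) = c * y \<alpha>"
proof -
  have "riesz d y (Poly_Mapping.single \<alpha> c) = (\<Sum>\<beta>\<in>midx_upto d. if \<beta> = \<alpha> then c * y \<beta> else 0)"
    unfolding riesz_def by (intro sum.cong) (auto simp: lookup_single when_def)
  also have "\<dots> = c * y \<alpha>"
    using assms finite_midx_upto[of d] by (subst sum.delta) (auto simp: midx_upto_def)
  finally show ?thesis .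
qed

lemma riesz_pconst: "riesz d y (pconst c) = c * y 0"
  unfolding pconst_def by (simp add: riesz_single)

text \<open>No product of two terms of \<open>q\<close> exceeds degree \<open>d\<close>, so the
  truncated functional sees the whole square; the moment matrix acts as its Gram matrix.\<close>

lemma riesz_square:
  assumes "poly_deg_le q (d div 2)"
  shows "riesz d y (q\<^sup>2) = quad_form (midx_upto (d div 2)) (moment_matrix y) (Poly_Mapping.lookup q)"
proof -
  have q: "Poly_Mapping.keys q \<subseteq> midx_upto (d div 2)"
    using assms by (simp add: poly_deg_le_def)
  have "riesz d y (q\<^sup>2) = (\<Sum>\<alpha>\<in>midx_upto (d div 2). \<Sum>\<beta>\<in>midx_upto (d div 2).
      riesz d y (Poly_Mapping.single (\<alpha> + \<beta>) (Poly_Mapping.lookup q \<alpha> * Poly_Mapping.lookup q \<beta>)))"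
    by (simp only: power2_eq_square riesz_sum
        mpoly_times_sum_of_terms[OF finite_midx_upto q finite_midx_upto q])
  also have "\<dots> = (\<Sum>\<alpha>\<in>midx_upto (d div 2). \<Sum>\<beta>\<in>midx_upto (d div 2).
      Poly_Mapping.lookup q \<alpha> * y (\<alpha> + \<beta>) * Poly_Mapping.lookup q \<beta>)"
    by (intro sum.cong refl) (subst riesz_single, auto simp: midx_upto_def mdeg_add)
  finally show ?thesis by (simp add: quad_form_def moment_matrix_def)
qed

lemma riesz_moments:
  assumes "poly_deg_le u d"
  shows "riesz d (moments x) u = peval u x"
  using assms unfolding riesz_def poly_deg_le_def by (simp add: peval_superset[OF finite_midx_upto])

text \<open>The moment matrix of a point mass is the outer product of the monomial vector with
  itself.\<close>

lemma psd_moment_matrix_moments: "psd (midx_upto r) (moment_matrix (moments x))"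
  unfolding psd_def
proof (intro conjI allI)
  show "sym_matrix (midx_upto r) (moment_matrix (moments x))"
    by (simp add: sym_matrix_def moment_matrix_def add.commute)
  fix v
  have "quad_form (midx_upto r) (moment_matrix (moments x)) v = (\<Sum>\<alpha>\<in>midx_upto r. v \<alpha> * moments x \<alpha>)\<^sup>2"
    by (simp add: quad_form_def moment_matrix_def moments_add power2_eq_square sum_product algebra_simps)
  then show "0 \<le> quad_form (midx_upto r) (moment_matrix (moments x)) v" by simp
qed

section \<open>Jensen's inequality for the Riesz functional\<close>

text \<open>Serves to freeze the base point in a certificate of SOS-convexity, so that its squares
  become polynomials in \<open>x\<close> alone.\<close>

lemma peval_partial_substitution:
  fixes q :: "('a::finite + 'b::finite) mpoly"
  shows "\<exists>r. \<forall>x. peval r x = peval q (\<chi> k. case k of Inl a \<Rightarrow> x $ a | Inr b \<Rightarrow> c $ b)"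
proof -
  define r where "r = (\<Sum>\<alpha>\<in>Poly_Mapping.keys q. pconst (Poly_Mapping.lookup q \<alpha>) *
    (\<Prod>k\<in>UNIV. (case k of Inl a \<Rightarrow> pvar a | Inr b \<Rightarrow> pconst (c $ b)) ^ Poly_Mapping.lookup \<alpha> k))"
  have "peval r x = peval q (\<chi> k. case k of Inl a \<Rightarrow> x $ a | Inr b \<Rightarrow> c $ b)" for x
    unfolding r_def peval_def[of q] peval_sum peval_mult peval_prod peval_power peval_pconst
    by (intro sum.cong prod.cong refl arg_cong2[where f = "(*)"] arg_cong2[where f = "(^)"])
      (simp split: sum.split)
  then show ?thesis by blast
qed

lemma sos_convex_riesz_jensen:
  fixes F :: "('n::finite) mpoly"
  assumes "sos_convex F" and deg: "poly_deg_le F d" and "0 < d"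
    and psd: "psd (midx_upto (d div 2)) (moment_matrix y)" and "y 0 = 1"
  shows "peval F (\<chi> a. riesz d y (pvar a)) \<le> riesz d y F"
proof -
  define xs where "xs = (\<chi> a. riesz d y (pvar a))"
  obtain g P where P: "\<And>x z. peval P (\<chi> k. case k of Inl a \<Rightarrow> x $ a | Inr b \<Rightarrow> z $ b) =
      peval F x - peval F z - g z \<bullet> (x - z)" and "sums_of_squares P"
    using assms(1) unfolding sos_convex_def by blast
  then obtain N q where q: "P = (\<Sum>i<N::nat. (q i)\<^sup>2)"
    unfolding sums_of_squares_def by blast
  obtain r where r: "\<And>i x. peval (r i) x = peval (q i) (\<chi> k. case k of Inl a \<Rightarrow> x $ a | Inr b \<Rightarrow> xs $ b)"
  proof -
    have "\<forall>i. \<exists>r. \<forall>x. peval r x = peval (q i) (\<chi> k. case k of Inl a \<Rightarrow> x $ a | Inr b \<Rightarrow> xs $ b)"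
      using peval_partial_substitution by blast
    then show ?thesis using that by metis
  qed
  \<comment> \<open>The gap between \<open>F\<close> and its tangent at \<open>xs\<close>, as a
    polynomial in the free variable.\<close>
  define T where "T = F - pconst (peval F xs) - (\<Sum>a\<in>UNIV. pconst (g xs $ a) * (pvar a - pconst (xs $ a)))"
  have T: "(\<Sum>i<N. (r i)\<^sup>2) = T"
  proof (rule peval_injective)
    fix x
    have "peval (\<Sum>i<N. (r i)\<^sup>2) x = peval P (\<chi> k. case k of Inl a \<Rightarrow> x $ a | Inr b \<Rightarrow> xs $ b)"
      by (simp add: r q)
    also have "\<dots> = peval T x"
      by (simp add: P T_def inner_vec_def)
    finally show "peval (\<Sum>i<N. (r i)\<^sup>2) x = peval T x" .
  qed
  \<comment> \<open>\<open>0 < d\<close> leaves room for the linear terms. The bound on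
    \<open>T\<close> limits each \<open>r i\<close> in the sum to degree \<open>d div 2\<close>,
    within reach of the moment matrix.\<close>
  have "poly_deg_le T d"
    unfolding T_def using deg \<open>0 < d\<close>
    by (intro poly_deg_le_diff poly_deg_le_sum poly_deg_le_pconst_mult poly_deg_le_pconst poly_deg_le_pvar) auto
  then have "poly_deg_le (r i) (d div 2)" if "i < N" for i
    using poly_deg_le_of_sum_of_squares[of r N d i] that by (simp add: T)
  then have "0 \<le> riesz d y (\<Sum>i<N. (r i)\<^sup>2)"
    using psd by (simp add: riesz_sum riesz_square psd_def sum_nonneg)
  \<comment> \<open>By the choice of \<open>xs\<close> and \<open>y 0 = 1\<close>,
    \<open>riesz d y\<close> sends \<open>pvar a - pconst (xs $ a)\<close> to 0, so the tangent
    contributes only its constant.\<close>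
  also have "\<dots> = riesz d y F - peval F xs"
    unfolding T by (simp add: T_def riesz_diff riesz_sum riesz_pconst_mult riesz_pconst \<open>y 0 = 1\<close> xs_def)
  finally show ?thesis by (simp add: xs_def)
qed

subsection \<open>The suprema over spectrahedral sets\<close>

lemma frobenius_pencil:
  "frobenius I Z (pencil m p A B y z) = frobenius I Z (A 0) +
    (\<Sum>j=1..m. y j * frobenius I Z (A j)) + (\<Sum>l=1..p. z l * frobenius I Z (B l))"
proof -
  have "pencil m p A B y z =
      (\<lambda>a b. (A 0 a b + (\<Sum>j=1..m. y j * A j a b)) + (\<Sum>l=1..p. z l * B l a b))"
    by (simp add: pencil_def fun_eq_iff)
  then show ?thesis by (simp only: frobenius_linear)
qed

text \<open>Compactness bounds each coordinate on \<open>\<Omega>\<close>, hence the set of values,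
  which makes the supremum a true upper bound.\<close>

lemma sup_function_upper:
  assumes "compactin (powertop_real {1..m}) \<Omega>" "y \<in> \<Omega>"
  shows "peval (h 0) x + (\<Sum>j=1..m. y j * peval (h j) x) \<le> sup_function m h \<Omega> x"
proof -
  have "\<exists>K. \<forall>y\<in>\<Omega>. \<bar>y j\<bar> \<le> K" if "j \<in> {1..m}" for j
  proof -
    have "compactin euclideanreal ((\<lambda>y. y j) ` \<Omega>)"
      using assms(1) continuous_map_product_projection[OF that] by (rule image_compactin)
    then have "bounded ((\<lambda>y. y j) ` \<Omega>)"
      by (simp add: compact_imp_bounded)
    then show ?thesis by (auto simp: bounded_iff)
  qed
  then obtain K where K: "\<And>j y. j \<in> {1..m} \<Longrightarrow> y \<in> \<Omega> \<Longrightarrow> \<bar>y j\<bar> \<le> K j"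
    by metis
  have "y j * peval (h j) x \<le> K j * \<bar>peval (h j) x\<bar>" if "j \<in> {1..m}" "y \<in> \<Omega>" for j y
  proof -
    have "y j * peval (h j) x \<le> \<bar>y j\<bar> * \<bar>peval (h j) x\<bar>"
      by (simp flip: abs_mult)
    also have "\<dots> \<le> K j * \<bar>peval (h j) x\<bar>"
      using K[OF that] by (rule mult_right_mono) simp
    finally show ?thesis .
  qed
  then have "bdd_above ((\<lambda>y. peval (h 0) x + (\<Sum>j=1..m. y j * peval (h j) x)) ` \<Omega>)"
    by (intro bdd_aboveI2[where M = "peval (h 0) x + (\<Sum>j=1..m. K j * \<bar>peval (h j) x\<bar>)"]
        add_left_mono sum_mono) auto
  with assms(2) show ?thesis
    unfolding sup_function_def by (intro cSUP_upper) auto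
qed

text \<open>Weak duality. For each \<open>y\<close> in \<open>\<Omega>\<close>, Jensen's inequality
  passes to \<open>riesz d w\<close>; the nonnegative pairing of \<open>Z\<close> with the pencil at
  \<open>y\<close>, rewritten by the equality constraints, then gives a bound free of
  \<open>y\<close>.\<close>

lemma sup_function_le_riesz:
  assumes A_sym: "\<And>j. j \<in> {0..m} \<Longrightarrow> sym_matrix {..<k} (A j)"
    and B_sym: "\<And>l. l \<in> {1..p} \<Longrightarrow> sym_matrix {..<k} (B l)"
    and \<Omega>: "\<Omega> = spectrahedral k m p A B" "\<Omega> \<noteq> {}"
    and deg: "\<And>j. j \<in> {0..m} \<Longrightarrow> poly_deg_le (h j) d" and "0 < d"
    and conv: "\<And>y. y \<in> \<Omega> \<Longrightarrow> sos_convex (h 0 + (\<Sum>j=1..m. pconst (y j) * h j))"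
    and Z: "psd {..<k} Z"
      "\<And>j. j \<in> {1..m} \<Longrightarrow> riesz d w (h j) + matrix_trace {..<k} (matrix_prod {..<k} Z (A j)) = 0"
      "\<And>l. l \<in> {1..p} \<Longrightarrow> matrix_trace {..<k} (matrix_prod {..<k} Z (B l)) = 0"
    and w: "psd (midx_upto (d div 2)) (moment_matrix w)" "w 0 = 1"
  shows "sup_function m h \<Omega> (\<chi> a. riesz d w (pvar a)) \<le>
    riesz d w (h 0) + matrix_trace {..<k} (matrix_prod {..<k} Z (A 0))"
  unfolding sup_function_def
proof (rule cSUP_least[OF \<Omega>(2)])
  fix y
  assume "y \<in> \<Omega>"
  then obtain z where z: "psd {..<k} (pencil m p A B y z)"
    using \<Omega>(1) by (auto simp: spectrahedral_def)
  define F where "F = h 0 + (\<Sum>j=1..m. pconst (y j) * h j)"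
  have ZA: "frobenius {..<k} Z (A j) = - riesz d w (h j)" if "j \<in> {1..m}" for j
    using Z(2)[OF that] A_sym[of j] that by (simp add: trace_prod_eq_frobenius)
  have ZB: "frobenius {..<k} Z (B l) = 0" if "l \<in> {1..p}" for l
    using Z(3)[OF that] B_sym[OF that] by (simp add: trace_prod_eq_frobenius)
  have "peval (h 0) (\<chi> a. riesz d w (pvar a)) + (\<Sum>j=1..m. y j * peval (h j) (\<chi> a. riesz d w (pvar a)))
      = peval F (\<chi> a. riesz d w (pvar a))"
    by (simp add: F_def)
  also have "\<dots> \<le> riesz d w F"
  proof (rule sos_convex_riesz_jensen)
    show "sos_convex F" using conv[OF \<open>y \<in> \<Omega>\<close>] by (simp add: F_def)
    show "poly_deg_le F d"
      unfolding F_def using deg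
      by (intro poly_deg_le_add poly_deg_le_sum poly_deg_le_pconst_mult) auto
  qed fact+
  also have "\<dots> = riesz d w (h 0) + (\<Sum>j=1..m. y j * riesz d w (h j))"
    by (simp add: F_def riesz_add riesz_sum riesz_pconst_mult)
  also have "\<dots> \<le> riesz d w (h 0) + frobenius {..<k} Z (A 0)"
  proof -
    have "(\<Sum>j=1..m. y j * frobenius {..<k} Z (A j)) = (\<Sum>j=1..m. - (y j * riesz d w (h j)))"
      by (intro sum.cong refl) (simp only: ZA mult_minus_right)
    moreover have "(\<Sum>l=1..p. z l * frobenius {..<k} Z (B l)) = 0"
      by (intro sum.neutral ballI) (simp only: ZB mult_zero_right)
    ultimately show ?thesis
      using frobenius_psd_nonneg[OF finite_lessThan Z(1) z]
      by (simp add: frobenius_pencil sum_negf)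
  qed
  also have "frobenius {..<k} Z (A 0) = matrix_trace {..<k} (matrix_prod {..<k} Z (A 0))"
    by (simp add: trace_prod_eq_frobenius A_sym)
  finally show "peval (h 0) (\<chi> a. riesz d w (pvar a)) + (\<Sum>j=1..m. y j * peval (h j) (\<chi> a. riesz d w (pvar a)))
    \<le> riesz d w (h 0) + matrix_trace {..<k} (matrix_prod {..<k} Z (A 0))" .
qed

text \<open>Strong duality with attainment. For fixed \<open>x\<close> an affine function of
  \<open>y\<close> is maximized over a linear matrix inequality in \<open>(y, z)\<close> that is
  strictly feasible by \<open>slater\<close>; \<open>Z\<close> is the multiplier.\<close>

lemma sup_function_dual_attained:
  assumes A_sym: "\<And>j. j \<in> {0..m} \<Longrightarrow> sym_matrix {..<k} (A j)"
    and B_sym: "\<And>l. l \<in> {1..p} \<Longrightarrow> sym_matrix {..<k} (B l)"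
    and \<Omega>: "\<Omega> = spectrahedral k m p A B" "compactin (powertop_real {1..m}) \<Omega>"
    and slater: "posdef {..<k} (pencil m p A B ybar zbar)"
  shows "\<exists>Z. psd {..<k} Z \<and>
    (\<forall>j\<in>{1..m}. peval (h j) x + matrix_trace {..<k} (matrix_prod {..<k} Z (A j)) = 0) \<and>
    (\<forall>l\<in>{1..p}. matrix_trace {..<k} (matrix_prod {..<k} Z (B l)) = 0) \<and>
    peval (h 0) x + matrix_trace {..<k} (matrix_prod {..<k} Z (A 0)) \<le> sup_function m h \<Omega> x"
proof -
  \<comment> \<open>\<open>Inl\<close> indexes the variables \<open>y\<close> and \<open>Inr\<close>
    the lifting variables \<open>z\<close>, which have cost 0; the constant term of the objective
    moves into \<open>v\<close>.\<close>
  define J where "J = {1..m} <+> {1..p}"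
  define E where "E = case_sum A B"
  define c where "c = case_sum (\<lambda>j. peval (h j) x) (\<lambda>_ :: nat. 0)"
  define v where "v = sup_function m h \<Omega> x - peval (h 0) x"
  have sumJ: "(\<Sum>j\<in>J. g j) = (\<Sum>j=1..m. g (Inl j)) + (\<Sum>l=1..p. g (Inr l))" for g :: "nat + nat \<Rightarrow> real"
    by (simp add: J_def sum.Plus comp_def)
  have pencil: "(\<lambda>a b. A 0 a b + (\<Sum>j\<in>J. l j * E j a b)) = pencil m p A B (l \<circ> Inl) (l \<circ> Inr)" for l
    by (simp add: fun_eq_iff pencil_def sumJ E_def)
  obtain Z where Z: "psd {..<k} Z" "\<And>j. j \<in> J \<Longrightarrow> frobenius {..<k} Z (E j) = - c j"
    "frobenius {..<k} Z (A 0) \<le> v"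
  proof (rule semidefinite_duality[where I = "{..<k}" and J = J and A = "A 0" and E = E
        and c = c and v = v and ls = "case_sum ybar zbar"])
    show "finite J" by (simp add: J_def)
    show "finite {..<k}" by simp
    show "sym_matrix {..<k} (A 0)" by (simp add: A_sym)
    show "sym_matrix {..<k} (E j)" if "j \<in> J" for j
      using that A_sym B_sym by (auto simp: J_def E_def)
    have "case_sum ybar zbar \<circ> Inl = ybar" "case_sum ybar zbar \<circ> Inr = zbar"
      by auto
    with slater show "posdef {..<k} (\<lambda>a b. A 0 a b + (\<Sum>j\<in>J. case_sum ybar zbar j * E j a b))"
      by (simp only: pencil)
    show "(\<Sum>j\<in>J. c j * l j) \<le> v" if "psd {..<k} (\<lambda>a b. A 0 a b + (\<Sum>j\<in>J. l j * E j a b))" for l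
    proof -
      \<comment> \<open>Members of \<open>\<Omega>\<close> are extensional; the pencil reads only
        the indices that the restriction keeps.\<close>
      define y where "y = restrict (l \<circ> Inl) {1..m}"
      have "pencil m p A B (l \<circ> Inl) (l \<circ> Inr) = pencil m p A B y (l \<circ> Inr)"
        by (simp add: fun_eq_iff pencil_def y_def)
      with that have "psd {..<k} (pencil m p A B y (l \<circ> Inr))" by (simp only: pencil)
      moreover have "y \<in> {1..m} \<rightarrow>\<^sub>E UNIV" by (simp add: y_def)
      ultimately have "y \<in> \<Omega>" unfolding \<Omega>(1) spectrahedral_def by blast
      from sup_function_upper[OF \<Omega>(2) this, of h x] show ?thesis
        by (simp add: v_def sumJ c_def y_def mult.commute)
    qed
  qed (use that in blast)
  show ?thesis
  proof (intro exI[of _ Z] conjI ballI)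
    fix j
    assume j: "j \<in> {1..m}"
    then have "Inl j \<in> J" by (auto simp: J_def)
    with j show "peval (h j) x + matrix_trace {..<k} (matrix_prod {..<k} Z (A j)) = 0"
      using Z(2)[of "Inl j"] A_sym[of j] by (simp add: E_def c_def trace_prod_eq_frobenius)
  next
    fix l
    assume l: "l \<in> {1..p}"
    then have "Inr l \<in> J" by (auto simp: J_def)
    with l show "matrix_trace {..<k} (matrix_prod {..<k} Z (B l)) = 0"
      using Z(2)[of "Inr l"] B_sym[of l] by (simp add: E_def c_def trace_prod_eq_frobenius)
  next
    show "peval (h 0) x + matrix_trace {..<k} (matrix_prod {..<k} Z (A 0)) \<le> sup_function m h \<Omega> x"
      using Z(3) A_sym[of 0] by (simp add: v_def trace_prod_eq_frobenius)
  qed (fact Z(1))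
qed

section \<open>Comparison of the program with its semidefinite relaxation\<close>

theorem theorem4p2:
  fixes d s m :: nat
    and p k :: "nat \<Rightarrow> nat"
    and h :: "nat \<Rightarrow> nat \<Rightarrow> ('n::finite) mpoly"
    and A B :: "nat \<Rightarrow> nat \<Rightarrow> nat \<Rightarrow> nat \<Rightarrow> real"
    and \<Omega> :: "nat \<Rightarrow> (nat \<Rightarrow> real) set"
    and f :: "nat \<Rightarrow> real ^ 'n \<Rightarrow> real"
    and ystar :: "'n midx \<Rightarrow> real"
    and Zstar :: "nat \<Rightarrow> nat \<Rightarrow> nat \<Rightarrow> real"
    and xstar :: "real ^ 'n"
  assumes d_pos: "0 < d" and d_even: "even d"
    and A_sym: "\<And>i j. i \<in> {0..s} \<Longrightarrow> j \<in> {0..m} \<Longrightarrow> sym_matrix {..<k i} (A i j)"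
    and B_sym: "\<And>i l. i \<in> {0..s} \<Longrightarrow> l \<in> {1..p i} \<Longrightarrow> sym_matrix {..<k i} (B i l)"
    and Omega_eq: "\<And>i. i \<in> {0..s} \<Longrightarrow> \<Omega> i = spectrahedral (k i) m (p i) (A i) (B i)"
    and Omega_nonempty: "\<And>i. i \<in> {0..s} \<Longrightarrow> \<Omega> i \<noteq> {}"
    and Omega_compact: "\<And>i. i \<in> {0..s} \<Longrightarrow> compactin (powertop_real {1..m}) (\<Omega> i)"
    and h_degree: "\<And>i j. i \<in> {0..s} \<Longrightarrow> j \<in> {0..m} \<Longrightarrow> poly_deg_le (h i j) d"
    and h_sos_convex: "\<And>i y. i \<in> {0..s} \<Longrightarrow> y \<in> \<Omega> i \<Longrightarrow>
          sos_convex (h i 0 + (\<Sum>j=1..m. pconst (y j) * h i j))"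
    and f_eq: "\<And>i. i \<in> {0..s} \<Longrightarrow> f i = sup_function m (h i) (\<Omega> i)"
    and slater_primal: "\<exists>xbar. \<forall>i\<in>{1..s}. f i xbar < 0"
    and slater_lmi: "\<And>i. i \<in> {0..s} \<Longrightarrow>
          \<exists>ybar zbar. posdef {..<k i} (pencil m (p i) (A i) (B i) ybar zbar)"
    and sdp_optimal: "is_arg_min (sdp_objective d k h A) (sdp_feasible d s m p k h A B)
          (ystar, Zstar)"
    and xstar_eq: "xstar = (\<chi> a. riesz d ystar (pvar a))"
  shows "is_arg_min (f 0) (\<lambda>x. \<forall>i\<in>{1..s}. f i x \<le> 0) xstar"
proof -
  \<comment> \<open>For \<open>i = 0\<close> the objective of the semidefinite program, for other
    \<open>i\<close> the left-hand side of its inequality constraints.\<close>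
  define b where "b = (\<lambda>y Z i. riesz d y (h i 0) + matrix_trace {..<k i} (matrix_prod {..<k i} (Z i) (A i 0)))"
  have feas: "sdp_feasible d s m p k h A B (ystar, Zstar)"
    and min: "\<And>w. sdp_feasible d s m p k h A B w \<Longrightarrow>
      sdp_objective d k h A (ystar, Zstar) \<le> sdp_objective d k h A w"
    using sdp_optimal by (auto simp: is_arg_min_def not_less)
  have f_le: "f i xstar \<le> b ystar Zstar i" if "i \<in> {0..s}" for i
    unfolding f_eq[OF that] xstar_eq b_def
    by (rule sup_function_le_riesz[OF A_sym[OF that] B_sym[OF that] Omega_eq[OF that]
          Omega_nonempty[OF that] h_degree[OF that] d_pos h_sos_convex[OF that]])
      (use feas that in \<open>auto simp: sdp_feasible_def\<close>)
  have obj: "f 0 xstar \<le> f 0 x" if x: "\<forall>i\<in>{1..s}. f i x \<le> 0" for x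
  proof -
    have "\<forall>i\<in>{0..s}. \<exists>Z. psd {..<k i} Z \<and>
      (\<forall>j\<in>{1..m}. peval (h i j) x + matrix_trace {..<k i} (matrix_prod {..<k i} Z (A i j)) = 0) \<and>
      (\<forall>l\<in>{1..p i}. matrix_trace {..<k i} (matrix_prod {..<k i} Z (B i l)) = 0) \<and>
      peval (h i 0) x + matrix_trace {..<k i} (matrix_prod {..<k i} Z (A i 0)) \<le> f i x"
    proof
      fix i
      assume i: "i \<in> {0..s}"
      obtain ybar zbar where "posdef {..<k i} (pencil m (p i) (A i) (B i) ybar zbar)"
        using slater_lmi[OF i] by blast
      then show "\<exists>Z. psd {..<k i} Z \<and>
        (\<forall>j\<in>{1..m}. peval (h i j) x + matrix_trace {..<k i} (matrix_prod {..<k i} Z (A i j)) = 0) \<and>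
        (\<forall>l\<in>{1..p i}. matrix_trace {..<k i} (matrix_prod {..<k i} Z (B i l)) = 0) \<and>
        peval (h i 0) x + matrix_trace {..<k i} (matrix_prod {..<k i} Z (A i 0)) \<le> f i x"
        unfolding f_eq[OF i]
        by (intro sup_function_dual_attained A_sym[OF i] B_sym[OF i] Omega_eq[OF i] Omega_compact[OF i])
    qed
    from bchoice[OF this] obtain Z where Z: "\<And>i. i \<in> {0..s} \<Longrightarrow> psd {..<k i} (Z i)"
      "\<And>i j. i \<in> {0..s} \<Longrightarrow> j \<in> {1..m} \<Longrightarrow>
        peval (h i j) x + matrix_trace {..<k i} (matrix_prod {..<k i} (Z i) (A i j)) = 0"
      "\<And>i l. i \<in> {0..s} \<Longrightarrow> l \<in> {1..p i} \<Longrightarrow> matrix_trace {..<k i} (matrix_prod {..<k i} (Z i) (B i l)) = 0"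
      "\<And>i. i \<in> {0..s} \<Longrightarrow>
        peval (h i 0) x + matrix_trace {..<k i} (matrix_prod {..<k i} (Z i) (A i 0)) \<le> f i x"
      by metis
    have riesz: "riesz d (moments x) (h i j) = peval (h i j) x" if "i \<in> {0..s}" "j \<in> {0..m}" for i j
      using h_degree[OF that] by (rule riesz_moments)
    have b_le: "b (moments x) Z i \<le> f i x" if "i \<in> {0..s}" for i
      using Z(4)[OF that] that by (simp add: b_def riesz)
    \<comment> \<open>The multipliers and the moments of the point mass at \<open>x\<close> are
      feasible, since \<open>b_le\<close> bounds each inequality constraint by
      \<open>f i x\<close>.\<close>
    have "sdp_feasible d s m p k h A B (moments x, Z)"
      unfolding sdp_feasible_def prod.case
    proof (intro conjI ballI)
      fix i
      assume i: "i \<in> {1..s}"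
      then show "riesz d (moments x) (h i 0) + matrix_trace {..<k i} (matrix_prod {..<k i} (Z i) (A i 0)) \<le> 0"
        using b_le[of i] x by (force simp: b_def)
    next
      fix i j
      assume "i \<in> {0..s}" "j \<in> {1..m}"
      then show "riesz d (moments x) (h i j) + matrix_trace {..<k i} (matrix_prod {..<k i} (Z i) (A i j)) = 0"
        using Z(2) riesz[of i j] by simp
    qed (use Z(1,3) psd_moment_matrix_moments in auto)
    \<comment> \<open>The chain is \<open>f 0 xstar \<le> b ystar Zstar 0 \<le> b (moments x) Z 0
      \<le> f 0 x\<close>.\<close>
    from min[OF this] have "b ystar Zstar 0 \<le> b (moments x) Z 0"
      by (simp add: sdp_objective_def b_def)
    then show ?thesis using f_le[of 0] b_le[of 0] by simp
  qed
  have "f i xstar \<le> 0" if "i \<in> {1..s}" for i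
    using f_le[of i] feas that unfolding sdp_feasible_def prod.case b_def by force
  then show ?thesis
    using obj by (auto simp: is_arg_min_def not_less)
qed

end
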